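(* Suppose the nodes are i.i.d. uniformly distributed in the unit square $S$, and the edge weight function $h:\mathbb{R}^2\times\mathbb{R}^2\to[0,\infty)$ is measurable and satisfies, for positive constants $c_1,c_2$, $c_1 d(x,y)\le h(x,y)=h(y,x)\le c_2 d(x,y)$ for all $x,y\in\mathbb{R}^2$, together with: (b1) for every $a>0$, $h(au,av)=a\,h(u,v)$ for all $u,v\in\mathbb{R}^2$; (b2) there is a constant $h_0>0$ such that $h(b+u,b+v)\le h_0\,h(u,v)$ for all $b,u,v\in\mathbb{R}^2$. If the edge weight exponent satisfies $0<\alpha<2$, then $$0<\liminf_{n}\frac{\mathbb{E}TSP_n}{n^{1-\frac{\alpha}{2}}}\le\limsup_{n}\frac{\mathbb{E}TSP_n}{n^{1-\frac{\alpha}{2}}}\le h_0^{\alpha}\cdot\liminf_{n}\frac{\mathbb{E}TSP_n}{n^{1-\frac{\alpha}{2}}}<\infty.$$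
   Context: $S=[-\frac12,\frac12]^2$ is the unit square, $d$ is Euclidean distance, and $X_1,X_2,\ldots$ are i.i.d. uniform on $S$. $K_n$ is the complete graph on the nodes $X_1,\ldots,X_n$; the edge $e=(X_i,X_j)$ has weight $h^\alpha(e)=h(X_i,X_j)^\alpha$. The weight of a cycle $\mathcal{C}$ is $W(\mathcal{C})=\sum_{e\in\mathcal{C}}h^\alpha(e)$, and $TSP_n$ is the minimum of $W(\mathcal{C})$ over all spanning (Hamiltonian) cycles $\mathcal{C}$ of $K_n$. *)

theory Defs
  imports "HOL-Probability.Probability"
begin

definition unit_square :: "(real^2) set" where
  "unit_square = {x. \<forall>i. - 1/2 \<le> x $ i \<and> x $ i \<le> 1/2}"

text \<open>
  A cycle through the vertices \<open>v\<^sub>1, \<dots>, v\<^sub>t\<close> is represented by the list of its vertices in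
  cyclic order. The nodes \<open>x 1, \<dots>, x n\<close> of the complete graph are identified with their
  indices, so they remain distinct vertices even where two positions coincide.
\<close>

definition hamiltonian_cycles :: "nat \<Rightarrow> nat list set" where
  "hamiltonian_cycles n = {vs. distinct vs \<and> set vs = {1..n} \<and> 3 \<le> length vs}"

text \<open>
  For a list of at least three distinct vertices, the consecutive pairs (including the closing
  pair from the last to the first vertex) are pairwise different as unordered edges, so the sum
  below counts each edge of the cycle exactly once.
\<close>

definition cycle_weight ::
  "('p \<Rightarrow> 'p \<Rightarrow> real) \<Rightarrow> real \<Rightarrow> (nat \<Rightarrow> 'p) \<Rightarrow> nat list \<Rightarrow> real" where
  "cycle_weight h \<alpha> x vs =
     (\<Sum>k<length vs. h (x (vs ! k)) (x (vs ! (Suc k mod length vs))) powr \<alpha>)"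

text \<open>Only meaningful for \<open>n \<ge> 3\<close>; there are no Hamiltonian cycles for smaller \<open>n\<close>.\<close>

definition TSP :: "('p \<Rightarrow> 'p \<Rightarrow> real) \<Rightarrow> real \<Rightarrow> (nat \<Rightarrow> 'p) \<Rightarrow> nat \<Rightarrow> real" where
  "TSP h \<alpha> x n = Min (cycle_weight h \<alpha> x ` hamiltonian_cycles n)"

lemma finite_hamiltonian_cycles: "finite (hamiltonian_cycles n)"
proof (rule finite_subset)
  show "hamiltonian_cycles n \<subseteq> {vs. set vs \<subseteq> {1..n} \<and> distinct vs}"
    by (auto simp: hamiltonian_cycles_def)
qed (simp add: finite_subset_distinct)

lemma hamiltonian_cycles_nonempty:
  assumes "3 \<le> n"
  shows "hamiltonian_cycles n \<noteq> {}"
proof -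
  have "[1..<Suc n] \<in> hamiltonian_cycles n"
    using assms by (auto simp: hamiltonian_cycles_def)
  then show ?thesis by blast
qed

end

theory Submission
  imports Defs
begin

text \<open>
  Let \<open>f n\<close> be the expected weight of the minimal tour through \<open>n\<close>
  independent uniform nodes and \<open>\<beta> = 1 - \<alpha>/2\<close>, so that \<open>0 <
  \<beta> < 1\<close>.

  \<^emph>\<open>The upper bounds.\<close> Cut the square into \<open>k^2\<close> cells of side
  \<open>1/k\<close> and join optimal tours of the nodes in each cell. Joining hierarchically over
  dyadic blocks costs \<open>O(k powr (2 - \<alpha>))\<close>, for every node configuration, with
  empty cells and without a triangle inequality; this is where \<open>\<alpha> < 2\<close> is
  needed (\<open>min_tour_dyadic\<close>). With \<open>k\<close> about \<open>sqrt n\<close> it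
  yields the worst-case bound \<open>O(n powr \<beta>)\<close> (\<open>tour_worst_case\<close>),
  hence finiteness. In general, (b1) and (b2) compare the weights in a cell with those in the
  whole square at the price of a factor \<open>h0/k\<close>, and a uniform point is a uniformly
  chosen cell with an independent uniform position in it. So, \<open>N\<close> denoting the
  binomial number of nodes in a cell, \<open>f n \<le> k^2 * (h0/k) powr \<alpha> * E (f N) + O(k
  powr (2 - \<alpha>))\<close> (\<open>mean_tour_cells\<close>).

  \<^emph>\<open>The factor \<open>h0 powr \<alpha>\<close>.\<close> Fix \<open>m\<close> and let
  \<open>n\<close> be large. Ideally the cells would contain \<open>m\<close> nodes each and the
  inequality, divided by \<open>n powr \<beta>\<close>, would bound \<open>f n / n powr
  \<beta>\<close> by \<open>h0 powr \<alpha> * f m / m powr \<beta>\<close> up to an error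
  vanishing with growing \<open>m\<close>. To pass from \<open>f N\<close> to \<open>f m\<close>
  one cannot use monotonicity, since deleting nodes may be expensive for a weight that is not a
  metric; but adding \<open>j\<close> nodes costs at most \<open>O(j powr \<beta> + 1)\<close>. So
  \<open>k\<close> is chosen such that the mean \<open>n/k^2\<close> of \<open>N\<close> exceeds
  \<open>m\<close> by about \<open>m powr (3/4)\<close>. Then \<open>N < m\<close> is improbable
  by Chebyshev's inequality, and the surplus is negligible (\<open>mean_tour_occupancy\<close>,
  \<open>eventually_mean_tour_ratio\<close>). This gives \<open>limsup (f n / n powr \<beta>)
  \<le> h0 powr \<alpha> * f m / m powr \<beta> + o(1)\<close> as \<open>m\<close> grows, and the
  claim follows by taking the limit inferior over \<open>m\<close>.

  \<^emph>\<open>The lower bound.\<close> On the scale \<open>r\<close> of order \<open>n powr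
  (-1/2)\<close>, the expected number of ordered pairs of nodes within distance \<open>r\<close>
  is at most \<open>n/2\<close>. Hence on average at least \<open>n/2\<close> edges of any tour
  have length at least \<open>r\<close>, and they weigh of order \<open>n powr \<beta>\<close> in total
  (\<open>mean_tour_ge\<close>).
\<close>

section \<open>Minimal tours of a finite node set\<close>

text \<open>
  The minimum is taken over all orderings of a node set \<open>J\<close>, including sets of fewer than three nodes, so
  that the nodes falling into a cell can be treated uniformly whatever their number. A tour
  of two nodes then runs along their edge twice, and a tour of one node is a loop.
\<close>

definition min_tour :: "('p \<Rightarrow> 'p \<Rightarrow> real) \<Rightarrow> real \<Rightarrow> (nat \<Rightarrow> 'p) \<Rightarrow> nat set \<Rightarrow> real" where
  "min_tour h \<alpha> x J = Min (cycle_weight h \<alpha> x ` {vs. distinct vs \<and> set vs = J})"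

lemma TSP_eq_min_tour: "TSP h \<alpha> x n = min_tour h \<alpha> x {1..n}" if "3 \<le> n"
proof -
  have "hamiltonian_cycles n = {vs. distinct vs \<and> set vs = {1..n}}"
    using that distinct_card unfolding hamiltonian_cycles_def by fastforce
  then show ?thesis by (simp add: TSP_def min_tour_def)
qed

lemma finite_orderings: "finite {vs. distinct vs \<and> set vs = J}" if "finite J"
  by (rule finite_subset[OF _ finite_subset_distinct[OF that]]) auto

lemma orderings_nonempty: "{vs. distinct vs \<and> set vs = J} \<noteq> {}" if "finite J"
  using finite_distinct_list[OF that] by blast

lemma min_tour_le: "min_tour h \<alpha> x (set vs) \<le> cycle_weight h \<alpha> x vs" if "distinct vs"
  unfolding min_tour_def using that by (intro Min_le finite_imageI finite_orderings) auto

lemma min_tour_attained: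
  assumes "finite J"
  obtains vs where "distinct vs" "set vs = J" "min_tour h \<alpha> x J = cycle_weight h \<alpha> x vs"
proof -
  have "min_tour h \<alpha> x J \<in> cycle_weight h \<alpha> x ` {vs. distinct vs \<and> set vs = J}"
    unfolding min_tour_def
    using orderings_nonempty[OF assms]
    by (intro Min_in finite_imageI finite_orderings assms) simp
  then show ?thesis using that by auto
qed

lemma min_tour_nonneg:
  assumes "finite J"
  shows "0 \<le> min_tour h \<alpha> x J"
proof -
  obtain vs where "distinct vs" "set vs = J" "min_tour h \<alpha> x J = cycle_weight h \<alpha> x vs"
    by (rule min_tour_attained[OF assms])
  then show ?thesis by (simp add: cycle_weight_def sum_nonneg)
qed

lemma cycle_weight_mono:
  assumes "\<And>i j. i \<in> set vs \<Longrightarrow> j \<in> set vs \<Longrightarrow> h (x i) (x j) powr \<alpha> \<le> c * h' (y i) (y j) powr \<alpha>"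
  shows "cycle_weight h \<alpha> x vs \<le> c * cycle_weight h' \<alpha> y vs"
  unfolding cycle_weight_def sum_distrib_left
  by (intro sum_mono assms) (auto intro!: nth_mem mod_less_divisor)

lemma min_tour_mono:
  assumes "finite J"
    and "\<And>i j. i \<in> J \<Longrightarrow> j \<in> J \<Longrightarrow> h (x i) (x j) powr \<alpha> \<le> c * h' (y i) (y j) powr \<alpha>"
  shows "min_tour h \<alpha> x J \<le> c * min_tour h' \<alpha> y J"
proof -
  obtain vs where vs: "distinct vs" "set vs = J" "min_tour h' \<alpha> y J = cycle_weight h' \<alpha> y vs"
    by (rule min_tour_attained[OF assms(1)])
  have "min_tour h \<alpha> x J \<le> cycle_weight h \<alpha> x vs"
    using min_tour_le[OF vs(1)] vs(2) by simp
  also have "\<dots> \<le> c * cycle_weight h' \<alpha> y vs"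
    using assms(2) vs(2) by (intro cycle_weight_mono) auto
  finally show ?thesis using vs(3) by simp
qed

lemma min_tour_cong:
  assumes "finite J" "\<And>i. i \<in> J \<Longrightarrow> x i = y i"
  shows "min_tour h \<alpha> x J = min_tour h \<alpha> y J"
  using min_tour_mono[of J h x \<alpha> 1 h y] min_tour_mono[of J h y \<alpha> 1 h x] assms
  by (intro antisym) auto

lemma min_tour_le_card:
  assumes "finite J" "\<And>i j. i \<in> J \<Longrightarrow> j \<in> J \<Longrightarrow> h (x i) (x j) powr \<alpha> \<le> B"
  shows "min_tour h \<alpha> x J \<le> real (card J) * B"
proof -
  obtain vs where vs: "distinct vs" "set vs = J"
    using finite_distinct_list[OF assms(1)] by auto
  have "cycle_weight h \<alpha> x vs \<le> (\<Sum>k<length vs. B)"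
    unfolding cycle_weight_def using vs(2)
    by (intro sum_mono assms(2)) (auto intro!: nth_mem mod_less_divisor)
  then show ?thesis
    using min_tour_le[OF vs(1), of h \<alpha> x] vs distinct_card[OF vs(1)] by simp
qed

text \<open>
  Relabelling nodes. This is what makes the expected minimum over i.i.d. nodes depend on the
  number of nodes alone.
\<close>

lemma min_tour_image:
  assumes "inj_on b I" "finite I"
  shows "min_tour h \<alpha> x (b ` I) = min_tour h \<alpha> (x \<circ> b) I"
proof -
  have cw: "cycle_weight h \<alpha> x (map b us) = cycle_weight h \<alpha> (x \<circ> b) us" for us
    unfolding cycle_weight_def
  proof (intro sum.cong)
    fix k assume "k \<in> {..<length us}"
    then have "Suc k mod length us < length us" by (intro mod_less_divisor) auto
    then show "h (x (map b us ! k)) (x (map b us ! (Suc k mod length (map b us)))) powr \<alpha> =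
        h ((x \<circ> b) (us ! k)) ((x \<circ> b) (us ! (Suc k mod length us))) powr \<alpha>"
      using \<open>k \<in> {..<length us}\<close> by simp
  qed simp
  have "{vs. distinct vs \<and> set vs = b ` I} = map b ` {us. distinct us \<and> set us = I}"
  proof (intro equalityI subsetI)
    fix vs assume vs: "vs \<in> {vs. distinct vs \<and> set vs = b ` I}"
    let ?us = "map (inv_into I b) vs"
    have "map b ?us = vs"
      using vs by (auto simp: f_inv_into_f intro!: map_idI)
    moreover have "set ?us = I"
      using vs assms by (auto simp: image_image)
    moreover have "distinct ?us"
      using vs by (auto simp: distinct_map intro: inj_on_inv_into)
    ultimately show "vs \<in> map b ` {us. distinct us \<and> set us = I}"
      by (metis (mono_tags, lifting) image_eqI mem_Collect_eq)
  qed (use assms in \<open>auto simp: distinct_map\<close>)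
  then show ?thesis unfolding min_tour_def by (simp add: image_image cw)
qed

section \<open>Joining tours\<close>

text \<open>
  The cyclic sum in \<open>cycle_weight\<close> is awkward to cut open, so a cycle is treated as the open
  path that returns to its first vertex.
\<close>

fun path_weight :: "('i \<Rightarrow> 'i \<Rightarrow> real) \<Rightarrow> 'i list \<Rightarrow> real" where
  "path_weight w (u # v # vs) = w u v + path_weight w (v # vs)"
| "path_weight w _ = 0"

lemma path_weight_append: "path_weight w (us @ v # vs) = path_weight w (us @ [v]) + path_weight w (v # vs)"
  by (induction w us rule: path_weight.induct) auto

lemma path_weight_sum: "path_weight w us = (\<Sum>k<length us - 1. w (us ! k) (us ! Suc k))"
proof (induction w us rule: path_weight.induct)
  case (1 w u v vs)
  have "(\<Sum>k<length (u # v # vs) - 1. w ((u # v # vs) ! k) ((u # v # vs) ! Suc k)) =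
      (\<Sum>k<Suc (length vs). w ((u # v # vs) ! k) ((u # v # vs) ! Suc k))" by simp
  also have "\<dots> = w u v + (\<Sum>k<length vs. w ((v # vs) ! k) ((v # vs) ! Suc k))"
    by (subst sum.lessThan_Suc_shift) simp
  finally show ?case using 1 by simp
qed auto

lemma cycle_weight_path:
  assumes "vs \<noteq> []"
  shows "cycle_weight h \<alpha> x vs = path_weight (\<lambda>i j. h (x i) (x j) powr \<alpha>) (vs @ [hd vs])"
  unfolding cycle_weight_def path_weight_sum
proof (rule sum.cong)
  fix k assume "k \<in> {..<length (vs @ [hd vs]) - 1}"
  then have k: "k < length vs" by simp
  have "(vs @ [hd vs]) ! Suc k = vs ! (Suc k mod length vs)"
  proof (cases "Suc k = length vs")
    case True
    then show ?thesis using assms by (simp add: nth_append hd_conv_nth)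
  next
    case False
    then show ?thesis using k by (simp add: nth_append)
  qed
  then show "h (x (vs ! k)) (x (vs ! (Suc k mod length vs))) powr \<alpha> =
      h (x ((vs @ [hd vs]) ! k)) (x ((vs @ [hd vs]) ! Suc k)) powr \<alpha>"
    using k by (simp add: nth_append)
qed simp

text \<open>
  Concatenating two cycles replaces the closing edge of each by an edge into the other cycle:
  the two removed edges weigh at least 0, the two new ones at most \<open>B\<close>.
\<close>

lemma cycle_weight_append:
  assumes "vs \<noteq> []" "ws \<noteq> []"
    and B: "\<And>i j. i \<in> set vs \<union> set ws \<Longrightarrow> j \<in> set vs \<union> set ws \<Longrightarrow> h (x i) (x j) powr \<alpha> \<le> B"
  shows "cycle_weight h \<alpha> x (vs @ ws) \<le> cycle_weight h \<alpha> x vs + cycle_weight h \<alpha> x ws + 2 * B"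
proof -
  let ?w = "\<lambda>i j. h (x i) (x j) powr \<alpha>"
  obtain b ws' where ws: "ws = b # ws'" using assms(2) by (cases ws) auto
  have replace: "path_weight ?w (us @ [v]) \<le> path_weight ?w (us @ [u]) + B"
    if "us \<noteq> []" "set us \<subseteq> set vs \<union> set ws" "v \<in> set vs \<union> set ws" for us u v
  proof -
    obtain us' y where us: "us = us' @ [y]"
      using \<open>us \<noteq> []\<close> by (cases us rule: rev_cases) auto
    have *: "path_weight ?w (us @ [z]) = path_weight ?w us + ?w y z" for z
      using path_weight_append[of ?w us' y "[z]"] by (simp add: us)
    have "?w y v \<le> B" using that us by (intro B) auto
    moreover have "0 \<le> ?w y u" by simp
    ultimately show ?thesis unfolding * by linarith
  qed
  have "cycle_weight h \<alpha> x (vs @ ws) = path_weight ?w (vs @ b # ws' @ [hd vs])"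
    using assms by (simp add: cycle_weight_path ws)
  also have "\<dots> = path_weight ?w (vs @ [b]) + path_weight ?w (ws @ [hd vs])"
    by (subst path_weight_append) (simp add: ws)
  also have "\<dots> \<le> (path_weight ?w (vs @ [hd vs]) + B) + (path_weight ?w (ws @ [hd ws]) + B)"
    using assms(1,2) ws by (intro add_mono replace) auto
  finally show ?thesis using assms(1,2) by (simp add: cycle_weight_path)
qed

lemma min_tour_empty [simp]: "min_tour h \<alpha> x {} = 0"
  by (simp add: min_tour_def cycle_weight_def conj_commute cong: conj_cong)

lemma min_tour_union:
  assumes fin: "finite J1" "finite J2" and disj: "J1 \<inter> J2 = {}" and "0 \<le> B"
    and B: "\<And>i j. i \<in> J1 \<union> J2 \<Longrightarrow> j \<in> J1 \<union> J2 \<Longrightarrow> h (x i) (x j) powr \<alpha> \<le> B"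
  shows "min_tour h \<alpha> x (J1 \<union> J2) \<le> min_tour h \<alpha> x J1 + min_tour h \<alpha> x J2 + 2 * B"
proof (cases "J1 = {} \<or> J2 = {}")
  case True
  then show ?thesis using \<open>0 \<le> B\<close> by auto
next
  case False
  obtain vs where vs: "distinct vs" "set vs = J1" "min_tour h \<alpha> x J1 = cycle_weight h \<alpha> x vs"
    by (rule min_tour_attained[OF fin(1)])
  obtain ws where ws: "distinct ws" "set ws = J2" "min_tour h \<alpha> x J2 = cycle_weight h \<alpha> x ws"
    by (rule min_tour_attained[OF fin(2)])
  have "min_tour h \<alpha> x (J1 \<union> J2) \<le> cycle_weight h \<alpha> x (vs @ ws)"
    using min_tour_le[of "vs @ ws"] vs ws disj by auto
  also have "\<dots> \<le> cycle_weight h \<alpha> x vs + cycle_weight h \<alpha> x ws + 2 * B"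
    using vs ws False B by (intro cycle_weight_append) auto
  finally show ?thesis using vs ws by simp
qed

lemma two_powr_less_four: "2 powr \<alpha> < 4" if "\<alpha> < 2" for \<alpha> :: real
proof -
  have "2 powr \<alpha> < (2::real) powr 2" using that by (intro powr_less_mono) auto
  then show ?thesis by simp
qed

text \<open>
  The labels \<open>l i\<close> are the grid cells containing the nodes. Optimal tours of the cells of a
  \<open>2^n\<close> by \<open>2^n\<close> block are joined hierarchically: four sub-blocks at a time, with three joins of
  two edges each, every edge being no longer than the block. The blocks of side \<open>2^j\<close> contribute
  about \<open>4^(n-j) * 2^(j*\<alpha>)\<close>, and for \<open>\<alpha> < 2\<close> these numbers form a geometric series dominated by
  the smallest blocks; hence the total is of the order of the number of cells. Visiting the cells
  in a snake-like order would not do for \<open>\<alpha> > 1\<close>, since long runs of empty cells then cost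
  too much.
  
  The negative term \<open>(2^n) powr \<alpha>\<close> makes the induction close: the constant \<open>C\<close> solves
  \<open>C * (4 - 2 powr \<alpha>) = 6 * 2 powr \<alpha>\<close>, the 6 counting the new edges at each level.
\<close>

lemma min_tour_dyadic:
  fixes l :: "nat \<Rightarrow> nat \<times> nat"
  assumes \<alpha>: "0 < \<alpha>" "\<alpha> < 2" and h0: "\<And>u v. 0 \<le> h u v" and D: "0 \<le> D"
    and close: "\<And>i j r a b. i \<in> J \<Longrightarrow> j \<in> J \<Longrightarrow> l i \<in> {a..<a+r} \<times> {b..<b+r} \<Longrightarrow>
      l j \<in> {a..<a+r} \<times> {b..<b+r} \<Longrightarrow> h (x i) (x j) \<le> D * real r"
    and J: "finite J" "l ` J \<subseteq> {a..<a+2^n} \<times> {b..<b+2^n}"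
  shows "min_tour h \<alpha> x J \<le> (\<Sum>p=a..<a+2^n. \<Sum>q=b..<b+2^n. min_tour h \<alpha> x {i\<in>J. l i = (p,q)})
    + 6 * 2 powr \<alpha> / (4 - 2 powr \<alpha>) * D powr \<alpha> * (4^n - (2^n) powr \<alpha>)"
  using close J
proof (induction n arbitrary: a b J)
  case 0
  then have "{i\<in>J. l i = (a,b)} = J" by auto
  then show ?case by simp
next
  case (Suc n)
  define C where "C = 6 * 2 powr \<alpha> / (4 - 2 powr \<alpha>)"
  define T where "T I = min_tour h \<alpha> x I" for I
  define N :: nat where "N = 2^n"
  have N2: "2 ^ Suc n = N + N" by (simp add: N_def)
  define Q where "Q p q = {i\<in>J. l i \<in> {p..<p+N} \<times> {q..<q+N}}" for p q
  define S where "S p q = (\<Sum>p'=p..<p+N. \<Sum>q'=q..<q+N. T {i\<in>J. l i = (p',q')})" for p q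
  define B where "B = (D * real (N + N)) powr \<alpha>"
  have B: "h (x i) (x j) powr \<alpha> \<le> B" if "i \<in> J" "j \<in> J" for i j
  proof -
    have "l i \<in> {a..<a+(N+N)} \<times> {b..<b+(N+N)}" "l j \<in> {a..<a+(N+N)} \<times> {b..<b+(N+N)}"
      using Suc.prems(3) that unfolding N2 by blast+
    then have "h (x i) (x j) \<le> D * real (N+N)" using that by (intro Suc.prems(1))
    then show ?thesis unfolding B_def using h0 \<alpha> by (intro powr_mono2) auto
  qed
  have "0 \<le> B" by (simp add: B_def)
  have fin: "finite (Q p q)" for p q using Suc.prems(2) by (simp add: Q_def)
  have sub: "Q p q \<subseteq> J" for p q by (auto simp: Q_def)
  have IH: "T (Q p q) \<le> S p q + C * D powr \<alpha> * (4^n - (2^n) powr \<alpha>)" for p q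
  proof -
    have "T (Q p q) \<le> (\<Sum>p'=p..<p+2^n. \<Sum>q'=q..<q+2^n. T {i\<in>Q p q. l i = (p',q')})
       + C * D powr \<alpha> * (4^n - (2^n) powr \<alpha>)"
      unfolding T_def C_def
      by (rule Suc.IH) (use Suc.prems(1) fin in \<open>auto simp: Q_def N_def\<close>)
    also have "(\<Sum>p'=p..<p+2^n. \<Sum>q'=q..<q+2^n. T {i\<in>Q p q. l i = (p',q')}) = S p q"
      unfolding S_def N_def
      by (intro sum.cong refl arg_cong[of _ _ T]) (auto simp: Q_def N_def)
    finally show ?thesis .
  qed
  have join: "T (I1 \<union> I2) \<le> T I1 + T I2 + 2 * B" if "I1 \<subseteq> J" "I2 \<subseteq> J" "I1 \<inter> I2 = {}" for I1 I2
    unfolding T_def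
  proof (intro min_tour_union \<open>0 \<le> B\<close> B)
    show "finite I1" "finite I2" using that Suc.prems(2) by (auto intro: finite_subset)
  qed (use that in auto)
  have cover: "J = (Q a b \<union> Q a (b+N)) \<union> (Q (a+N) b \<union> Q (a+N) (b+N))"
  proof (intro equalityI subsetI)
    fix i assume i: "i \<in> J"
    obtain p q where pq: "l i = (p, q)" by fastforce
    have "(p, q) \<in> {a..<a+(N+N)} \<times> {b..<b+(N+N)}"
      using Suc.prems(3) i unfolding N2 pq[symmetric] by blast
    then have "a \<le> p" "p < a+N \<or> a+N \<le> p" "p < a+N+N" "b \<le> q" "q < b+N \<or> b+N \<le> q" "q < b+N+N"
      by auto
    then show "i \<in> (Q a b \<union> Q a (b+N)) \<union> (Q (a+N) b \<union> Q (a+N) (b+N))"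
      using i unfolding Q_def by (simp add: pq) argo
  qed (use sub in auto)
  have "T J \<le> T (Q a b \<union> Q a (b+N)) + T (Q (a+N) b \<union> Q (a+N) (b+N)) + 2 * B"
    by (subst cover, rule join) (auto simp: Q_def)
  also have "T (Q a b \<union> Q a (b+N)) \<le> T (Q a b) + T (Q a (b+N)) + 2 * B"
    by (rule join) (auto simp: Q_def)
  also have "T (Q (a+N) b \<union> Q (a+N) (b+N)) \<le> T (Q (a+N) b) + T (Q (a+N) (b+N)) + 2 * B"
    by (rule join) (auto simp: Q_def)
  finally have "T J \<le> T (Q a b) + T (Q a (b+N)) + T (Q (a+N) b) + T (Q (a+N) (b+N)) + 6 * B"
    by simp
  also have "\<dots> \<le> S a b + S a (b+N) + S (a+N) b + S (a+N) (b+N)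
      + (4 * (C * D powr \<alpha> * (4^n - (2^n) powr \<alpha>)) + 6 * B)"
    using IH[of a b] IH[of a "b+N"] IH[of "a+N" b] IH[of "a+N" "b+N"] by linarith
  also have "S a b + S a (b+N) + S (a+N) b + S (a+N) (b+N) =
      (\<Sum>p=a..<a+2^Suc n. \<Sum>q=b..<b+2^Suc n. T {i\<in>J. l i = (p,q)})"
  proof -
    have split: "(\<Sum>i=c..<c+(N+N). f i) = (\<Sum>i=c..<c+N. f i) + (\<Sum>i=c+N..<c+N+N. f i)"
      for c and f :: "nat \<Rightarrow> real"
      by (subst sum.atLeastLessThan_concat) (auto simp: add.assoc)
    show ?thesis unfolding N2 split sum.distrib S_def by simp
  qed
  also have "4 * (C * D powr \<alpha> * (4^n - (2^n) powr \<alpha>)) + 6 * B =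
      C * D powr \<alpha> * (4^Suc n - (2^Suc n) powr \<alpha>)"
  proof -
    have BB: "B = D powr \<alpha> * (2 powr \<alpha> * (2^n) powr \<alpha>)"
      using D by (simp add: B_def N_def powr_mult flip: mult_2)
    have CC: "C * (4 - 2 powr \<alpha>) = 6 * 2 powr \<alpha>"
      using two_powr_less_four[OF \<alpha>(2)] by (simp add: C_def)
    have "4 * (C * D powr \<alpha> * (4^n - (2^n) powr \<alpha>)) + 6 * B =
      C * D powr \<alpha> * (4 * 4^n) - 4 * C * D powr \<alpha> * (2^n) powr \<alpha> + 6 * 2 powr \<alpha> * D powr \<alpha> * (2^n) powr \<alpha>"
      unfolding BB by (simp add: algebra_simps)
    also have "\<dots> = C * D powr \<alpha> * (4 * 4^n - 2 powr \<alpha> * (2^n) powr \<alpha>)"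
      unfolding CC[symmetric] by (simp add: algebra_simps)
    finally show ?thesis by (simp add: powr_mult)
  qed
  finally show ?case by (simp add: T_def C_def)
qed

text \<open>
  A grid of arbitrary size \<open>k\<close> is embedded into the next dyadic one, which has at most four times as
  many cells. Arbitrary \<open>k\<close> matters: the mean number of nodes per cell must later be adjusted
  within a factor close to 1, which powers of two do not allow.
\<close>

lemma min_tour_grid:
  fixes l :: "nat \<Rightarrow> nat \<times> nat"
  assumes \<alpha>: "0 < \<alpha>" "\<alpha> < 2" and h0: "\<And>u v. 0 \<le> h u v" and D: "0 \<le> D"
    and close: "\<And>i j r a b. i \<in> J \<Longrightarrow> j \<in> J \<Longrightarrow> l i \<in> {a..<a+r} \<times> {b..<b+r} \<Longrightarrow>
      l j \<in> {a..<a+r} \<times> {b..<b+r} \<Longrightarrow> h (x i) (x j) \<le> D * real r"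
    and J: "finite J" "l ` J \<subseteq> {..<k} \<times> {..<k}" and k: "1 \<le> k"
  shows "min_tour h \<alpha> x J \<le> (\<Sum>c\<in>{..<k}\<times>{..<k}. min_tour h \<alpha> x {i\<in>J. l i = c})
    + 24 * 2 powr \<alpha> / (4 - 2 powr \<alpha>) * D powr \<alpha> * real k ^ 2"
proof -
  obtain n where n: "k \<le> 2^n" "2^n \<le> 2 * k"
  proof -
    define n where "n = (LEAST n. k \<le> 2^n)"
    have ex: "k \<le> 2^k" by (rule less_imp_le) (rule less_exp)
    have 1: "k \<le> 2^n" unfolding n_def by (rule LeastI[of _ k], rule ex)
    have 2: "2^n \<le> 2 * k"
    proof (cases n)
      case 0
      then show ?thesis using k by simp
    next
      case (Suc m)
      then have "\<not> k \<le> 2^m" using not_less_Least[of m "\<lambda>n. k \<le> 2^n"] n_def by auto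
      then show ?thesis using Suc by simp
    qed
    show ?thesis using that 1 2 by blast
  qed
  let ?C = "6 * 2 powr \<alpha> / (4 - 2 powr \<alpha>) * D powr \<alpha>"
  have C: "0 \<le> ?C" using two_powr_less_four[OF \<alpha>(2)] by simp
  have "min_tour h \<alpha> x J \<le> (\<Sum>p=0..<0+2^n. \<Sum>q=0..<0+2^n. min_tour h \<alpha> x {i\<in>J. l i = (p,q)})
    + ?C * (4^n - (2^n) powr \<alpha>)"
  proof (intro min_tour_dyadic assms)
    show "l ` J \<subseteq> {0..<0+2^n} \<times> {0..<0+2^n}"
      using J(2) n(1) by (fastforce simp: subset_iff mem_Times_iff)
  qed
  also have "(\<Sum>p=0..<0+2^n. \<Sum>q=0..<0+2^n. min_tour h \<alpha> x {i\<in>J. l i = (p,q)}) =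
      (\<Sum>c\<in>{..<2^n}\<times>{..<2^n}. min_tour h \<alpha> x {i\<in>J. l i = c})"
    by (subst sum.cartesian_product) (auto simp: atLeast0LessThan intro!: sum.cong)
  also have "\<dots> = (\<Sum>c\<in>{..<k}\<times>{..<k}. min_tour h \<alpha> x {i\<in>J. l i = c})"
  proof (rule sum.mono_neutral_right)
    show "\<forall>c\<in>{..<2^n}\<times>{..<2^n} - {..<k}\<times>{..<k}. min_tour h \<alpha> x {i\<in>J. l i = c} = 0"
    proof
      fix c assume "c \<in> {..<2^n}\<times>{..<2^n} - {..<k}\<times>{..<k}"
      then have "{i\<in>J. l i = c} = {}" using J(2) by auto
      then show "min_tour h \<alpha> x {i\<in>J. l i = c} = 0" by (simp only: min_tour_empty)
    qed
  qed (use n in auto)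
  also have "?C * (4^n - (2^n) powr \<alpha>) \<le> ?C * (4 * real k ^ 2)"
  proof (rule mult_left_mono[OF _ C])
    have "real (2^n) \<le> real (2 * k)" using n(2) by (rule of_nat_mono)
    then have "(2^n)^2 \<le> (2 * real k)^2" by (intro power_mono) auto
    moreover have "(4::real)^n = (2^n)^2" by (simp add: power2_eq_square flip: power_mult_distrib)
    ultimately have "(4::real)^n \<le> 4 * real k ^ 2" by (simp add: power_mult_distrib)
    moreover have "0 \<le> (2^n::real) powr \<alpha>" by simp
    ultimately show "4^n - (2^n) powr \<alpha> \<le> 4 * real k ^ 2" by linarith
  qed
  finally show ?thesis by (simp add: mult_ac)
qed

section \<open>Uniform points in the square and in its cells\<close>

abbreviation (input) unif :: "(real^2) measure" where
  "unif \<equiv> uniform_measure lborel unit_square"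

lemma unit_square_cbox: "unit_square = cbox (\<chi> i. - 1/2) (\<chi> i. 1/2)"
  by (auto simp: unit_square_def mem_box_cart)

lemma unit_square_borel [measurable]: "unit_square \<in> sets borel"
  by (simp add: unit_square_cbox)

lemma emeasure_unit_square: "emeasure lborel unit_square = 1"
proof -
  have side: "((\<chi> i. 1/2) - (\<chi> i. - 1/2)) \<bullet> b = (1::real)" if "b \<in> Basis" for b :: "real^2"
    using that by (auto simp: Basis_vec_def inner_axis)
  have "\<And>b::real^2. b \<in> Basis \<Longrightarrow> (\<chi> i. - 1/2) \<bullet> b \<le> (\<chi> i. 1/2) \<bullet> b"
    using side by (simp add: inner_diff_left algebra_simps)
  moreover have "prod ((\<bullet>) ((\<chi> i. 1/2) - (\<chi> i. - 1/2))) (Basis :: (real^2) set) = 1"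
    using side by (intro prod.neutral) blast
  ultimately show ?thesis
    unfolding unit_square_cbox by (subst emeasure_lborel_cbox) auto
qed

lemma prob_space_unif: "prob_space unif"
  by (rule prob_space_uniform_measure) (simp_all add: emeasure_unit_square)

lemma AE_unif: "AE x in unif. x \<in> unit_square"
  by (rule AE_uniform_measureI) auto

text \<open>
  The cells of side \<open>1/k\<close> are indexed by their column and row, counted from the lower left corner.
\<close>

definition cell_center :: "nat \<Rightarrow> nat \<times> nat \<Rightarrow> real^2" where
  "cell_center k c = vector [(2 * real (fst c) + 1 - real k) / (2 * real k),
                             (2 * real (snd c) + 1 - real k) / (2 * real k)]"

definition cell_map :: "nat \<Rightarrow> nat \<times> nat \<Rightarrow> real^2 \<Rightarrow> real^2" where
  "cell_map k c y = cell_center k c + (1 / real k) *\<^sub>R y"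

lemma cell_map_measurable [measurable]: "cell_map k c \<in> borel_measurable borel"
  unfolding cell_map_def by measurable

lemma unit_square_iff: "x \<in> unit_square \<longleftrightarrow> \<bar>x $ 1\<bar> \<le> 1/2 \<and> \<bar>x $ 2\<bar> \<le> 1/2"
  by (auto simp: unit_square_def forall_2 abs_le_iff)

lemma unit_interval_cell:
  assumes "\<bar>t\<bar> \<le> 1/2" "1 \<le> k"
  obtains a where "a < k" "\<bar>real k * (t - (2 * real a + 1 - real k) / (2 * real k))\<bar> \<le> 1/2"
proof -
  define s where "s = real k * (t + 1/2)"
  have s: "0 \<le> s" "s \<le> real k"
    using assms by (auto simp: s_def abs_le_iff intro!: mult_left_le)
  have eq: "real k * (t - (2 * real a + 1 - real k) / (2 * real k)) = s - real a - 1/2" for a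
    using assms(2) by (simp add: s_def field_simps)
  show ?thesis
  proof (cases "s = real k")
    case True
    show ?thesis
    proof (rule that[of "k - 1"])
      show "\<bar>real k * (t - (2 * real (k - 1) + 1 - real k) / (2 * real k))\<bar> \<le> 1/2"
        unfolding eq True using assms(2) by (simp add: of_nat_diff)
    qed (use assms(2) in simp)
  next
    case False
    show ?thesis
    proof (rule that[of "nat \<lfloor>s\<rfloor>"])
      show "nat \<lfloor>s\<rfloor> < k" using s False by linarith
      show "\<bar>real k * (t - (2 * real (nat \<lfloor>s\<rfloor>) + 1 - real k) / (2 * real k))\<bar> \<le> 1/2"
        unfolding eq using s by linarith
    qed
  qed
qed

lemma unit_square_cell:
  assumes "x \<in> unit_square" "1 \<le> k"
  obtains c where "c \<in> {..<k} \<times> {..<k}" "real k *\<^sub>R (x - cell_center k c) \<in> unit_square"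
proof -
  obtain a where a: "a < k" "\<bar>real k * (x $ 1 - (2 * real a + 1 - real k) / (2 * real k))\<bar> \<le> 1/2"
    using assms by (auto simp: unit_square_iff intro: unit_interval_cell)
  obtain b where b: "b < k" "\<bar>real k * (x $ 2 - (2 * real b + 1 - real k) / (2 * real k))\<bar> \<le> 1/2"
    using assms by (auto simp: unit_square_iff intro: unit_interval_cell)
  show ?thesis
    by (rule that[of "(a, b)"]) (use a b in \<open>auto simp: unit_square_iff cell_center_def\<close>)
qed

lemma nn_integral_lborel_affine:
  fixes f :: "'a::euclidean_space \<Rightarrow> ennreal"
  assumes [measurable]: "f \<in> borel_measurable borel" and "s \<noteq> 0"
  shows "(\<integral>\<^sup>+x. f x \<partial>lborel) = ennreal (\<bar>s\<bar> ^ DIM('a)) * (\<integral>\<^sup>+y. f (t + s *\<^sub>R y) \<partial>lborel)"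
  by (subst lborel_affine[OF \<open>s \<noteq> 0\<close>, of t])
     (simp add: nn_integral_density nn_integral_distr nn_integral_cmult)

text \<open>
  A uniform point of the square is a uniformly chosen cell together with an independent uniform
  position in it. The statement is one-sided because an upper bound suffices for expected tour
  weights; this way it needs the cells to cover the square, not to be almost disjoint.
\<close>

lemma nn_integral_unif_cells:
  assumes [measurable]: "g \<in> borel_measurable borel" and k: "1 \<le> k"
  shows "(\<integral>\<^sup>+x. g x \<partial>unif) \<le>
    ennreal (1 / real k ^ 2) * (\<Sum>c\<in>{..<k}\<times>{..<k}. \<integral>\<^sup>+y. g (cell_map k c y) \<partial>unif)"
proof -
  have unif: "(\<integral>\<^sup>+x. f x \<partial>unif) = (\<integral>\<^sup>+x. f x * indicator unit_square x \<partial>lborel)"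
    if [measurable]: "f \<in> borel_measurable borel" for f :: "real^2 \<Rightarrow> ennreal"
    by (subst nn_integral_uniform_measure) (auto simp: emeasure_unit_square divide_ennreal_def)
  have one_cell: "(\<integral>\<^sup>+x. g x * indicator unit_square (real k *\<^sub>R (x - cell_center k c)) \<partial>lborel) =
      ennreal (1 / real k ^ 2) * (\<integral>\<^sup>+y. g (cell_map k c y) \<partial>unif)" for c
  proof -
    have "(\<integral>\<^sup>+x. g x * indicator unit_square (real k *\<^sub>R (x - cell_center k c)) \<partial>lborel) =
      ennreal (\<bar>1 / real k\<bar> ^ DIM(real^2)) * (\<integral>\<^sup>+y. g (cell_center k c + (1 / real k) *\<^sub>R y) *
        indicator unit_square (real k *\<^sub>R ((cell_center k c + (1 / real k) *\<^sub>R y) - cell_center k c)) \<partial>lborel)"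
    proof (rule nn_integral_lborel_affine)
      have "(\<lambda>x. real k *\<^sub>R (x - cell_center k c)) \<in> borel_measurable borel" by measurable
      from measurable_compose[OF this borel_measurable_indicator[OF unit_square_borel]]
      show "(\<lambda>x. g x * indicator unit_square (real k *\<^sub>R (x - cell_center k c))) \<in> borel_measurable borel"
        by (intro borel_measurable_times_ennreal assms(1))
    qed (use k in simp)
    also have "\<dots> = ennreal (1 / real k ^ 2) * (\<integral>\<^sup>+y. g (cell_map k c y) * indicator unit_square y \<partial>lborel)"
      using k by (simp add: cell_map_def power_divide)
    finally show ?thesis by (simp add: unif)
  qed
  have "(\<integral>\<^sup>+x. g x \<partial>unif) = (\<integral>\<^sup>+x. g x * indicator unit_square x \<partial>lborel)" by (simp add: unif)
  also have "\<dots> \<le> (\<integral>\<^sup>+x. (\<Sum>c\<in>{..<k}\<times>{..<k}.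
      g x * indicator unit_square (real k *\<^sub>R (x - cell_center k c))) \<partial>lborel)"
  proof (rule nn_integral_mono)
    fix x
    show "g x * indicator unit_square x \<le> (\<Sum>c\<in>{..<k}\<times>{..<k}.
      g x * indicator unit_square (real k *\<^sub>R (x - cell_center k c)))"
    proof (cases "x \<in> unit_square")
      case True
      then obtain c where c: "c \<in> {..<k} \<times> {..<k}" "real k *\<^sub>R (x - cell_center k c) \<in> unit_square"
        by (rule unit_square_cell[OF _ k])
      have "g x * indicator unit_square x = g x * indicator unit_square (real k *\<^sub>R (x - cell_center k c))"
        using True c by simp
      also have "\<dots> \<le> (\<Sum>c\<in>{..<k}\<times>{..<k}.
          g x * indicator unit_square (real k *\<^sub>R (x - cell_center k c)))"
        using c by (intro member_le_sum) auto
      finally show ?thesis .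
    qed simp
  qed
  also have "\<dots> = (\<Sum>c\<in>{..<k}\<times>{..<k}. ennreal (1 / real k ^ 2) * (\<integral>\<^sup>+y. g (cell_map k c y) \<partial>unif))"
    by (subst nn_integral_sum) (measurable, auto intro!: sum.cong simp: one_cell)
  finally show ?thesis by (simp add: sum_distrib_left)
qed

lemma sum_PiE_insert:
  assumes "i \<notin> I"
  shows "(\<Sum>l\<in>insert i I \<rightarrow>\<^sub>E L. F l) = (\<Sum>c\<in>L. \<Sum>l\<in>I \<rightarrow>\<^sub>E L. F (l(i := c)))"
proof -
  have "(\<Sum>l\<in>insert i I \<rightarrow>\<^sub>E L. F l) = (\<Sum>(c, l)\<in>L \<times> (I \<rightarrow>\<^sub>E L). F (l(i := c)))"
    unfolding PiE_insert_eq
    by (subst sum.reindex[OF inj_combinator[OF assms]]) (simp add: case_prod_unfold)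
  then show ?thesis by (simp add: sum.cartesian_product)
qed

text \<open>
  The same for a finite family of independent points: if the law \<open>M\<close> of one point is dominated by
  the mixture of its images under the maps \<open>\<phi> c\<close>, then the joint law is dominated by the mixture over all
  label functions \<open>l\<close>, with independent points of law \<open>M\<close> inside. Fixing the labels first keeps
  the conditioning on which nodes lie in which cell out of the argument altogether.
\<close>

lemma nn_integral_PiM_mixture:
  assumes M: "prob_space M" and [measurable]: "\<And>c. \<phi> c \<in> measurable M M"
    and mix: "\<And>g. g \<in> borel_measurable M \<Longrightarrow>
      (\<integral>\<^sup>+x. g x \<partial>M) \<le> w * (\<Sum>c\<in>L. \<integral>\<^sup>+y. g (\<phi> c y) \<partial>M)"
    and "finite I"
    and "G \<in> borel_measurable (PiM I (\<lambda>_. M))"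
  shows "(\<integral>\<^sup>+x. G x \<partial>PiM I (\<lambda>_. M)) \<le>
    w ^ card I * (\<Sum>l\<in>I \<rightarrow>\<^sub>E L. \<integral>\<^sup>+y. G (\<lambda>i\<in>I. \<phi> (l i) (y i)) \<partial>PiM I (\<lambda>_. M))"
  using \<open>finite I\<close> \<open>G \<in> _\<close>
proof (induction I arbitrary: G)
  case empty
  have "(\<integral>\<^sup>+x. G x \<partial>PiM {} (\<lambda>_. M)) = G (\<lambda>k. undefined)" for G :: "('c \<Rightarrow> 'a) \<Rightarrow> ennreal"
    unfolding PiM_empty by (subst nn_integral_count_space_finite) auto
  from this[of G] this[of "\<lambda>_. G (\<lambda>k. undefined)"] show ?case by (simp add: restrict_def)
next
  case (insert i I)
  note [measurable] = insert.prems
  interpret prob_space M by (rule M)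
  interpret product_sigma_finite "\<lambda>_. M" by standard
  have [measurable]: "(\<lambda>(x, y). x(i := \<phi> c y)) \<in>
      measurable (PiM I (\<lambda>_. M) \<Otimes>\<^sub>M M) (PiM (insert i I) (\<lambda>_. M))" for c
    unfolding case_prod_unfold
    by (rule measurable_fun_upd[where J=I]) measurable
  have [measurable]: "(\<lambda>y. x(i := y)) \<in> measurable M (PiM (insert i I) (\<lambda>_. M))"
    if "x \<in> space (PiM I (\<lambda>_. M))" for x
    by (rule measurable_fun_upd[where J=I]) (use that in auto)
  define H where "H c x = (\<integral>\<^sup>+y. G (x(i := \<phi> c y)) \<partial>M)" for c x
  have H [measurable]: "H c \<in> borel_measurable (PiM I (\<lambda>_. M))" for c
    unfolding H_def
    by (rule borel_measurable_nn_integral) (simp add: case_prod_unfold[symmetric])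
  have "(\<integral>\<^sup>+x. G x \<partial>PiM (insert i I) (\<lambda>_. M)) = (\<integral>\<^sup>+x. (\<integral>\<^sup>+y. G (x(i := y)) \<partial>M) \<partial>PiM I (\<lambda>_. M))"
    using insert.hyps by (intro product_nn_integral_insert) auto
  also have "\<dots> \<le> (\<integral>\<^sup>+x. w * (\<Sum>c\<in>L. H c x) \<partial>PiM I (\<lambda>_. M))"
    unfolding H_def by (intro nn_integral_mono mix) measurable
  also have "\<dots> = w * (\<Sum>c\<in>L. \<integral>\<^sup>+x. H c x \<partial>PiM I (\<lambda>_. M))"
    by (simp add: nn_integral_cmult nn_integral_sum)
  also have "\<dots> \<le> w * (\<Sum>c\<in>L. w ^ card I *
      (\<Sum>l\<in>I \<rightarrow>\<^sub>E L. \<integral>\<^sup>+x. H c (\<lambda>j\<in>I. \<phi> (l j) (x j)) \<partial>PiM I (\<lambda>_. M)))"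
    by (intro mult_left_mono sum_mono insert.IH H) simp
  also have "\<dots> = w ^ card (insert i I) * (\<Sum>c\<in>L. \<Sum>l\<in>I \<rightarrow>\<^sub>E L.
      \<integral>\<^sup>+x. H c (\<lambda>j\<in>I. \<phi> (l j) (x j)) \<partial>PiM I (\<lambda>_. M))"
    using insert.hyps by (simp add: sum_distrib_left mult.assoc)
  also have "(\<Sum>c\<in>L. \<Sum>l\<in>I \<rightarrow>\<^sub>E L. \<integral>\<^sup>+x. H c (\<lambda>j\<in>I. \<phi> (l j) (x j)) \<partial>PiM I (\<lambda>_. M)) =
      (\<Sum>c\<in>L. \<Sum>l\<in>I \<rightarrow>\<^sub>E L. \<integral>\<^sup>+y. G (\<lambda>j\<in>insert i I. \<phi> ((l(i := c)) j) (y j)) \<partial>PiM (insert i I) (\<lambda>_. M))"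
  proof (intro sum.cong refl)
    fix c l
    have "(\<integral>\<^sup>+y. G (\<lambda>j\<in>insert i I. \<phi> ((l(i := c)) j) (y j)) \<partial>PiM (insert i I) (\<lambda>_. M)) =
      (\<integral>\<^sup>+x. (\<integral>\<^sup>+y. G (\<lambda>j\<in>insert i I. \<phi> ((l(i := c)) j) ((x(i := y)) j)) \<partial>M) \<partial>PiM I (\<lambda>_. M))"
      using insert.hyps by (intro product_nn_integral_insert) measurable
    also have "\<dots> = (\<integral>\<^sup>+x. H c (\<lambda>j\<in>I. \<phi> (l j) (x j)) \<partial>PiM I (\<lambda>_. M))"
      unfolding H_def using insert.hyps
      by (intro nn_integral_cong arg_cong[of _ _ G]) (auto simp: fun_eq_iff)
    finally show "(\<integral>\<^sup>+x. H c (\<lambda>j\<in>I. \<phi> (l j) (x j)) \<partial>PiM I (\<lambda>_. M)) =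
      (\<integral>\<^sup>+y. G (\<lambda>j\<in>insert i I. \<phi> ((l(i := c)) j) (y j)) \<partial>PiM (insert i I) (\<lambda>_. M))" by simp
  qed
  finally show ?case by (simp only: sum_PiE_insert[OF insert.hyps(2)])
qed

text \<open>
  The binomial variance, written as a sum over all assignments of \<open>I\<close> to the cells: \<open>z\<close> is the
  centred count, \<open>e\<close> the centred contribution of the new node. The cross term vanishes because \<open>e\<close> has
  sum 0.
\<close>

lemma sum_occupancy_variance:
  fixes L :: "'c set"
  assumes "finite I" "finite L" "c \<in> L"
  shows "(\<Sum>l\<in>I \<rightarrow>\<^sub>E L. (real (card {i\<in>I. l i = c}) - real (card I) / real (card L))\<^sup>2) =
    real (card L) ^ card I * (real (card I) * (1 / real (card L) * (1 - 1 / real (card L))))"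
  using assms(1)
proof (induction I)
  case empty
  then show ?case by simp
next
  case (insert i I)
  define K where "K = real (card L)"
  have K: "K > 0" using assms(2,3) by (auto simp: K_def intro: card_gt_0_iff[THEN iffD2])
  define e where "e c' = (if c' = c then 1 else 0) - 1 / K" for c'
  define z where "z l = real (card {j\<in>I. l j = c}) - real (card I) / K" for l
  define V where "V = 1 / K * (1 - 1 / K)"
  have e1: "(\<Sum>c'\<in>L. e c') = 0"
    using assms(2,3) K by (simp add: e_def sum_subtractf flip: K_def)
  have e2: "(\<Sum>c'\<in>L. (e c')\<^sup>2) = K * V"
  proof -
    have "(\<Sum>c'\<in>L. (e c')\<^sup>2) = (\<Sum>c'\<in>L. (if c' = c then 1 - 2 / K else 0) + (1 / K)\<^sup>2)"
      by (intro sum.cong) (auto simp: e_def power2_eq_square algebra_simps)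
    also have "\<dots> = 1 - 2 / K + K * (1 / K)\<^sup>2"
      using assms by (simp add: sum.distrib K_def)
    also have "\<dots> = K * V" using K by (simp add: V_def power2_eq_square field_simps)
    finally show ?thesis .
  qed
  have step: "real (card {j\<in>insert i I. (l(i := c')) j = c}) - real (card (insert i I)) / K = z l + e c'"
    for l c'
  proof -
    have "{j\<in>insert i I. (l(i := c')) j = c} =
        (if c' = c then insert i {j\<in>I. l j = c} else {j\<in>I. l j = c})"
      using insert.hyps by auto
    then have "card {j\<in>insert i I. (l(i := c')) j = c} =
        (if c' = c then Suc (card {j\<in>I. l j = c}) else card {j\<in>I. l j = c})"
      using insert.hyps by simp
    then show ?thesis using insert.hyps by (simp add: z_def e_def add_divide_distrib)
  qed
  have cardE: "real (card (I \<rightarrow>\<^sub>E L)) = K ^ card I"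
    using insert.hyps by (simp add: card_PiE K_def)
  have IH: "(\<Sum>l\<in>I \<rightarrow>\<^sub>E L. (z l)\<^sup>2) = K ^ card I * (real (card I) * V)"
    using insert.IH by (simp add: z_def K_def V_def)
  have "(\<Sum>l\<in>insert i I \<rightarrow>\<^sub>E L. (real (card {j\<in>insert i I. l j = c}) - real (card (insert i I)) / K)\<^sup>2) =
      (\<Sum>c'\<in>L. \<Sum>l\<in>I \<rightarrow>\<^sub>E L. (z l + e c')\<^sup>2)"
    by (subst sum_PiE_insert[OF insert.hyps(2)]) (simp only: step)
  also have "\<dots> = (\<Sum>c'\<in>L. (\<Sum>l\<in>I \<rightarrow>\<^sub>E L. (z l)\<^sup>2) + 2 * e c' * (\<Sum>l\<in>I \<rightarrow>\<^sub>E L. z l) + K ^ card I * (e c')\<^sup>2)"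
    by (simp add: power2_sum sum.distrib sum_distrib_left cardE algebra_simps)
  also have "\<dots> = K * (K ^ card I * (real (card I) * V)) + 2 * (\<Sum>c'\<in>L. e c') * (\<Sum>l\<in>I \<rightarrow>\<^sub>E L. z l)
      + K ^ card I * (\<Sum>c'\<in>L. (e c')\<^sup>2)"
    by (simp add: sum.distrib IH K_def flip: sum_distrib_left sum_distrib_right)
  also have "\<dots> = K ^ card (insert i I) * (real (card (insert i I)) * V)"
    using insert.hyps by (simp add: e1 e2 algebra_simps)
  finally show ?case by (simp add: K_def V_def)
qed

section \<open>Deterministic bounds for homogeneous weights\<close>

locale homogeneous_weight =
  fixes h :: "real^2 \<Rightarrow> real^2 \<Rightarrow> real" and c2 h0 \<alpha> :: real
  assumes h_measurable: "(\<lambda>(u, v). h u v) \<in> borel_measurable borel"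
    and h_nonneg: "0 \<le> h u v"
    and c2_pos: "0 < c2"
    and h_le_dist: "h u v \<le> c2 * dist u v"
    and h_scaling: "0 < a \<Longrightarrow> h (a *\<^sub>R u) (a *\<^sub>R v) = a * h u v"
    and h0_pos: "0 < h0"
    and h_translation: "h (b + u) (b + v) \<le> h0 * h u v"
    and alpha_pos: "0 < \<alpha>" and alpha_less_2: "\<alpha> < 2"
begin

abbreviation tour :: "(nat \<Rightarrow> real^2) \<Rightarrow> nat set \<Rightarrow> real" where
  "tour \<equiv> min_tour h \<alpha>"

text \<open>
  The factor 2 bounds the \<open>L\<^sup>1\<close>-diameter of the square. Coordinatewise estimates are additive in
  the cell indices, and the value of the constants is irrelevant for the limits.
\<close>

definition edge_max :: real where "edge_max = (2 * c2) powr \<alpha>"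

definition join_const :: real where
  "join_const = 24 * 2 powr \<alpha> / (4 - 2 powr \<alpha>) * edge_max"

definition tour_const :: real where
  "tour_const = edge_max + join_const * 2 powr (2 - \<alpha>)"

lemma edge_max_pos: "0 < edge_max"
  using c2_pos by (simp add: edge_max_def)

lemma join_const_nonneg: "0 \<le> join_const"
  using edge_max_pos two_powr_less_four[OF alpha_less_2] by (simp add: join_const_def)

lemma tour_const_pos: "0 < tour_const"
  using edge_max_pos join_const_nonneg by (simp add: tour_const_def add_pos_nonneg)

lemma h_le_coordinates:
  assumes "\<bar>u $ 1 - v $ 1\<bar> \<le> d" "\<bar>u $ 2 - v $ 2\<bar> \<le> d"
  shows "h u v \<le> 2 * c2 * d"
proof -
  have "dist u v \<le> \<bar>u $ 1 - v $ 1\<bar> + \<bar>u $ 2 - v $ 2\<bar>"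
    using norm_le_l1_cart[of "u - v"] by (simp add: dist_norm sum_2)
  then have "c2 * dist u v \<le> c2 * (2 * d)"
    using assms c2_pos by (intro mult_left_mono) auto
  then show ?thesis using h_le_dist[of u v] by simp
qed

lemma edge_le_edge_max:
  assumes "u \<in> unit_square" "v \<in> unit_square"
  shows "h u v powr \<alpha> \<le> edge_max"
proof -
  have "h u v \<le> 2 * c2 * 1"
    using assms by (intro h_le_coordinates) (auto simp: unit_square_iff)
  then show ?thesis
    unfolding edge_max_def using h_nonneg alpha_pos by (intro powr_mono2) auto
qed

lemma cell_map_component_1: "cell_map k c y $ 1 = (2 * real (fst c) + 1 - real k) / (2 * real k) + y $ 1 / real k"
  and cell_map_component_2: "cell_map k c y $ 2 = (2 * real (snd c) + 1 - real k) / (2 * real k) + y $ 2 / real k"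
  by (simp_all add: cell_map_def cell_center_def)

lemma h_cells_le:
  assumes y: "y \<in> unit_square" "y' \<in> unit_square" and k: "1 \<le> k"
    and c: "c \<in> {a..<a+r} \<times> {b..<b+r}" "c' \<in> {a..<a+r} \<times> {b..<b+r}"
  shows "h (cell_map k c y) (cell_map k c' y') \<le> 2 * c2 / real k * real r"
proof -
  have coord: "\<bar>((2 * real p + 1 - real k) / (2 * real k) + s / real k) -
      ((2 * real p' + 1 - real k) / (2 * real k) + s' / real k)\<bar> \<le> real r / real k"
    if "p \<in> {q..<q+r}" "p' \<in> {q..<q+r}" "\<bar>s\<bar> \<le> 1/2" "\<bar>s'\<bar> \<le> 1/2" for p p' q s s'
  proof -
    have "((2 * real p + 1 - real k) / (2 * real k) + s / real k) -
      ((2 * real p' + 1 - real k) / (2 * real k) + s' / real k) =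
      (real p - real p' + s - s') / real k"
      using k by (simp add: field_simps)
    moreover have "\<bar>real p - real p' + s - s'\<bar> \<le> real r"
    proof -
      have "\<bar>real p - real p'\<bar> \<le> real r - 1" using that(1,2) by auto
      then show ?thesis using that(3,4) by linarith
    qed
    ultimately show ?thesis using k by (simp add: divide_right_mono)
  qed
  have "h (cell_map k c y) (cell_map k c' y') \<le> 2 * c2 * (real r / real k)"
    using y c unfolding unit_square_iff
    by (intro h_le_coordinates) (auto simp only: cell_map_component_1 cell_map_component_2 mem_Times_iff intro!: coord)
  then show ?thesis by simp
qed

text \<open>
  This is where (b1) and (b2) enter, and the only source of the factor \<open>h0 powr \<alpha>\<close>: a cell is
  a translate of the square shrunk by \<open>k\<close>.
\<close>

lemma h_cell_map:
  assumes "1 \<le> k"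
  shows "h (cell_map k c u) (cell_map k c v) powr \<alpha> \<le> h0 powr \<alpha> * real k powr - \<alpha> * h u v powr \<alpha>"
proof -
  have "h (cell_map k c u) (cell_map k c v) \<le> h0 * h ((1 / real k) *\<^sub>R u) ((1 / real k) *\<^sub>R v)"
    unfolding cell_map_def by (rule h_translation)
  also have "\<dots> = h0 * (1 / real k * h u v)"
    using assms by (subst h_scaling) auto
  finally have "h (cell_map k c u) (cell_map k c v) powr \<alpha> \<le> (h0 * (1 / real k * h u v)) powr \<alpha>"
    using h_nonneg alpha_pos by (intro powr_mono2) auto
  also have "\<dots> = h0 powr \<alpha> * real k powr - \<alpha> * h u v powr \<alpha>"
    using h0_pos h_nonneg[of u v] by (simp add: powr_mult powr_divide powr_minus field_simps)
  finally show ?thesis .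
qed

lemma tour_cells:
  assumes J: "finite J" and k: "1 \<le> k" and l: "l ` J \<subseteq> {..<k} \<times> {..<k}"
    and x: "\<And>i. i \<in> J \<Longrightarrow> x i = cell_map k (l i) (y i)" and y: "\<And>i. i \<in> J \<Longrightarrow> y i \<in> unit_square"
  shows "tour x J \<le> (\<Sum>c\<in>{..<k}\<times>{..<k}. tour x {i\<in>J. l i = c}) + join_const * real k powr (2 - \<alpha>)"
proof -
  have "tour x J \<le> (\<Sum>c\<in>{..<k}\<times>{..<k}. tour x {i\<in>J. l i = c})
    + 24 * 2 powr \<alpha> / (4 - 2 powr \<alpha>) * (2 * c2 / real k) powr \<alpha> * real k ^ 2"
  proof (rule min_tour_grid[OF alpha_pos alpha_less_2 h_nonneg])
    fix i j r a b
    assume "i \<in> J" "j \<in> J" "l i \<in> {a..<a + r} \<times> {b..<b + r}" "l j \<in> {a..<a + r} \<times> {b..<b + r}"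
    then show "h (x i) (x j) \<le> 2 * c2 / real k * real r"
      using x y k by (simp only: x) (intro h_cells_le)
  qed (use c2_pos k l J in auto)
  also have "(2 * c2 / real k) powr \<alpha> * real k ^ 2 = edge_max * real k powr (2 - \<alpha>)"
    using k c2_pos by (simp add: edge_max_def powr_divide powr_diff)
  then have "24 * 2 powr \<alpha> / (4 - 2 powr \<alpha>) * (2 * c2 / real k) powr \<alpha> * real k ^ 2 =
      join_const * real k powr (2 - \<alpha>)"
    by (simp add: join_const_def mult.assoc)
  finally show ?thesis by simp
qed

text \<open>
  A deterministic bound of the right order. With \<open>k\<close> about \<open>sqrt n\<close> cells per side, visiting the nodes of
  each cell in any order costs at most \<open>n\<close> edges of length of order \<open>1/k\<close>, and the joins
  cost of order \<open>k powr (2 - \<alpha>)\<close>; both are of order \<open>n powr (1 - \<alpha>/2)\<close>.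
\<close>

lemma tour_worst_case:
  assumes J: "finite J" and x: "\<And>i. i \<in> J \<Longrightarrow> x i \<in> unit_square"
  shows "tour x J \<le> tour_const * real (card J) powr (1 - \<alpha> / 2)"
proof (cases "J = {}")
  case True
  then show ?thesis by simp
next
  case False
  define n where "n = card J"
  have n: "1 \<le> n" using False J by (simp add: n_def Suc_leI card_gt_0_iff)
  define k where "k = nat \<lceil>sqrt (real n)\<rceil>"
  have sqrt_powr: "sqrt (real n) = real n powr (1/2)" by (simp add: powr_half_sqrt)
  have sqrt1: "1 \<le> sqrt (real n)" using n by simp
  have k1: "sqrt (real n) \<le> real k" unfolding k_def using sqrt1 by linarith
  have k2: "real k \<le> 2 * sqrt (real n)" unfolding k_def using sqrt1 by linarith
  have k: "1 \<le> k" using k1 sqrt1 by linarith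
  have "\<forall>i\<in>J. \<exists>c. c \<in> {..<k} \<times> {..<k} \<and> real k *\<^sub>R (x i - cell_center k c) \<in> unit_square"
    using x unit_square_cell[OF _ k] by metis
  then obtain l where l: "\<And>i. i \<in> J \<Longrightarrow> l i \<in> {..<k} \<times> {..<k}"
      "\<And>i. i \<in> J \<Longrightarrow> real k *\<^sub>R (x i - cell_center k (l i)) \<in> unit_square"
    by metis
  define y where "y i = real k *\<^sub>R (x i - cell_center k (l i))" for i
  have y: "y i \<in> unit_square" if "i \<in> J" for i
    unfolding y_def using that by (rule l(2))
  have xy: "x i = cell_map k (l i) (y i)" for i
    using k by (simp add: y_def cell_map_def)
  have "tour x J \<le> (\<Sum>c\<in>{..<k}\<times>{..<k}. tour x {i\<in>J. l i = c}) + join_const * real k powr (2 - \<alpha>)"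
    by (rule tour_cells[OF J k _ xy y]) (use l(1) in blast)
  also have "(\<Sum>c\<in>{..<k}\<times>{..<k}. tour x {i\<in>J. l i = c}) \<le>
      (\<Sum>c\<in>{..<k}\<times>{..<k}. real (card {i\<in>J. l i = c}) * (2 * c2 / real k) powr \<alpha>)"
  proof (intro sum_mono min_tour_le_card)
    fix c i j assume ij: "i \<in> {i\<in>J. l i = c}" "j \<in> {i\<in>J. l i = c}"
    have "h (cell_map k (l i) (y i)) (cell_map k (l j) (y j)) \<le> 2 * c2 / real k * real 1"
      using ij y k by (intro h_cells_le[where a="fst c" and b="snd c"]) auto
    then show "h (x i) (x j) powr \<alpha> \<le> (2 * c2 / real k) powr \<alpha>"
      using h_nonneg alpha_pos by (intro powr_mono2) (auto simp flip: xy)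
  qed (use J in auto)
  also have "\<dots> = real n * (2 * c2 / real k) powr \<alpha>"
  proof -
    have "(\<Sum>c\<in>{..<k}\<times>{..<k}. card {i\<in>J. l i = c}) = card J"
      using sum.group[of J "{..<k}\<times>{..<k}" l "\<lambda>_. 1::nat"] J l(1) by (auto simp: image_subset_iff)
    then show ?thesis by (simp only: n_def sum_distrib_right[symmetric] of_nat_sum[symmetric])
  qed
  also have "\<dots> \<le> edge_max * real n powr (1 - \<alpha> / 2)"
  proof -
    have "(2 * c2 / real k) powr \<alpha> \<le> (2 * c2 / sqrt (real n)) powr \<alpha>"
      using k k1 n c2_pos alpha_pos by (intro powr_mono2 divide_left_mono mult_pos_pos) auto
    also have "\<dots> = edge_max * real n powr (- \<alpha> / 2)"
      unfolding sqrt_powr using n c2_pos by (simp add: edge_max_def powr_divide powr_minus_divide powr_powr)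
    finally have "real n * (2 * c2 / real k) powr \<alpha> \<le> real n * (edge_max * real n powr (- \<alpha> / 2))"
      by (intro mult_left_mono) auto
    also have "\<dots> = edge_max * (real n powr 1 * real n powr (- \<alpha> / 2))"
      using n by simp
    finally show ?thesis unfolding powr_add[symmetric] by simp
  qed
  also have "join_const * real k powr (2 - \<alpha>) \<le> join_const * (2 powr (2 - \<alpha>) * real n powr (1 - \<alpha> / 2))"
  proof (rule mult_left_mono[OF _ join_const_nonneg])
    have "real k powr (2 - \<alpha>) \<le> (2 * sqrt (real n)) powr (2 - \<alpha>)"
      using k2 alpha_less_2 by (intro powr_mono2) auto
    also have "\<dots> = 2 powr (2 - \<alpha>) * real n powr (1 - \<alpha> / 2)"
      unfolding sqrt_powr by (simp add: powr_mult powr_powr diff_divide_distrib)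
    finally show "real k powr (2 - \<alpha>) \<le> 2 powr (2 - \<alpha>) * real n powr (1 - \<alpha> / 2)" .
  qed
  finally show ?thesis by (simp add: tour_const_def n_def algebra_simps)
qed

section \<open>Expected weight of the minimal tour\<close>

lemma measurable_tour:
  assumes "finite J" "\<And>i. i \<in> J \<Longrightarrow> X i \<in> borel_measurable N"
  shows "(\<lambda>\<omega>. tour (\<lambda>i. X i \<omega>) J) \<in> borel_measurable N"
  unfolding min_tour_def
proof (rule borel_measurable_Min[OF finite_orderings[OF assms(1)]])
  fix vs assume vs: "vs \<in> {vs. distinct vs \<and> set vs = J}"
  have "(\<lambda>\<omega>. h (X i \<omega>) (X j \<omega>)) \<in> borel_measurable N" if "i \<in> J" "j \<in> J" for i j
  proof -
    have "(\<lambda>\<omega>. (X i \<omega>, X j \<omega>)) \<in> borel_measurable N"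
      using assms(2) that by (intro borel_measurable_Pair) auto
    from measurable_compose[OF this h_measurable] show ?thesis by simp
  qed
  moreover have "vs ! (Suc k mod length vs) \<in> J" "vs ! k \<in> J" if "k < length vs" for k
  proof -
    have "Suc k mod length vs < length vs" using that by (intro mod_less_divisor) auto
    then show "vs ! (Suc k mod length vs) \<in> J" "vs ! k \<in> J" using vs that by auto
  qed
  ultimately show "(\<lambda>\<omega>. cycle_weight h \<alpha> (\<lambda>i. X i \<omega>) vs) \<in> borel_measurable N"
    unfolding cycle_weight_def
    by (intro borel_measurable_sum powr_real_measurable borel_measurable_const) auto
qed

abbreviation nodes :: "nat set \<Rightarrow> (nat \<Rightarrow> real^2) measure" where
  "nodes I \<equiv> PiM I (\<lambda>_. unif)"

lemma prob_space_nodes: "prob_space (nodes I)"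
  by (intro prob_space_PiM prob_space_unif)

lemma integrable_const_nodes [simp]: "integrable (nodes I) (\<lambda>_. a :: real)"
  by (intro finite_measure.integrable_const prob_space.finite_measure prob_space_nodes)

lemma measure_space_nodes [simp]: "measure (nodes I) (space (nodes I)) = 1"
  by (rule prob_space.prob_space[OF prob_space_nodes])

lemma measurable_tour_nodes:
  assumes "finite J" "J \<subseteq> I"
  shows "(\<lambda>y. tour y J) \<in> borel_measurable (nodes I)"
proof (rule measurable_tour[OF assms(1), of "\<lambda>i y. y i"])
  fix i assume "i \<in> J"
  then have "(\<lambda>y. y i) \<in> measurable (nodes I) unif"
    using assms(2) by (intro measurable_component_singleton) auto
  then show "(\<lambda>y. y i) \<in> borel_measurable (nodes I)"
    by (simp cong: measurable_cong_sets)
qed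

lemma AE_nodes:
  assumes "finite I"
  shows "AE y in nodes I. \<forall>i\<in>I. y i \<in> unit_square"
  using assms by (intro AE_finite_allI AE_PiM_component prob_space_unif AE_unif)

lemma integrable_tour:
  assumes "finite I" "J \<subseteq> I"
  shows "integrable (nodes I) (\<lambda>y. tour y J)"
proof -
  interpret prob_space "nodes I" by (rule prob_space_nodes)
  have J: "finite J" using assms by (rule finite_subset[rotated])
  show ?thesis
  proof (rule integrable_const_bound[where B="tour_const * real (card J) powr (1 - \<alpha> / 2)"])
    show "AE y in nodes I. norm (tour y J) \<le> tour_const * real (card J) powr (1 - \<alpha> / 2)"
      using AE_nodes[OF assms(1)]
    proof eventually_elim
      case (elim y)
      then show ?case
        using tour_worst_case[OF J, of y] min_tour_nonneg[OF J, of h \<alpha> y] assms(2) by auto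
    qed
  qed (rule measurable_tour_nodes[OF J assms(2)])
qed

definition mean_tour :: "nat \<Rightarrow> real" where
  "mean_tour n = (\<integral>y. tour y {1..n} \<partial>nodes {1..n})"

lemma mean_tour_nonneg: "0 \<le> mean_tour n"
  unfolding mean_tour_def by (intro integral_nonneg_AE AE_I2 min_tour_nonneg) simp

text \<open>
  The nodes in a given index set \<open>J\<close> are again i.i.d. uniform, whatever other nodes there are.
\<close>

lemma integral_tour:
  assumes "finite I" "J \<subseteq> I"
  shows "(\<integral>y. tour y J \<partial>nodes I) = mean_tour (card J)"
proof -
  have J: "finite J" using assms by (rule finite_subset[rotated])
  define m where "m = card J"
  obtain b where b: "bij_betw b {1..m} J"
    using ex_bij_betw_nat_finite_1[OF J] m_def by auto
  have img: "b ` {1..m} = J" and inj: "inj_on b {1..m}" using b by (auto simp: bij_betw_def)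
  let ?r = "\<lambda>y. \<lambda>i\<in>{1..m}. y (b i)"
  have r: "?r \<in> measurable (nodes I) (nodes {1..m})"
    using img assms(2) by (intro measurable_restrict measurable_component_singleton) auto
  have "nodes {1..m} = distr (nodes I) (nodes {1..m}) ?r"
    using distr_PiM_reindex[of I "\<lambda>_. unif" b "{1..m}"] prob_space_unif inj img assms(2)
    by (force simp: Pi_iff)
  then have "mean_tour m = (\<integral>y. tour y {1..m} \<partial>distr (nodes I) (nodes {1..m}) ?r)"
    by (simp add: mean_tour_def)
  also have "\<dots> = (\<integral>y. tour (?r y) {1..m} \<partial>nodes I)"
    by (rule integral_distr[OF r]) (rule measurable_tour_nodes, auto)
  also have "\<dots> = (\<integral>y. tour y J \<partial>nodes I)"
  proof (intro Bochner_Integration.integral_cong refl)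
    fix y
    have "tour (?r y) {1..m} = tour (y \<circ> b) {1..m}" by (intro min_tour_cong) auto
    also have "\<dots> = tour y J" using min_tour_image[OF inj, of h \<alpha> y] img by simp
    finally show "tour (?r y) {1..m} = tour y J" .
  qed
  finally show ?thesis by (simp add: m_def)
qed

lemma mean_tour_le: "mean_tour n \<le> tour_const * real n powr (1 - \<alpha> / 2)"
proof -
  interpret prob_space "nodes {1..n}" by (rule prob_space_nodes)
  have "mean_tour n \<le> (\<integral>y. tour_const * real n powr (1 - \<alpha> / 2) \<partial>nodes {1..n})"
    unfolding mean_tour_def
  proof (rule integral_mono_AE)
    show "AE y in nodes {1..n}. tour y {1..n} \<le> tour_const * real n powr (1 - \<alpha> / 2)"
      using AE_nodes[OF finite_atLeastAtMost]
    proof eventually_elim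
      case (elim y)
      then show ?case using tour_worst_case[of "{1..n}" y] by simp
    qed
  qed (use integrable_tour in blast, rule integrable_const)
  then show ?thesis by (simp)
qed

text \<open>
  Adding nodes costs at most the worst-case tour of the new ones and two joining edges. There is
  no such comparison in the other direction: \<open>h\<close> need not satisfy the triangle inequality, so
  deleting a node may increase the minimum.
\<close>

lemma mean_tour_add:
  assumes "m \<le> n"
  shows "mean_tour n \<le> mean_tour m + tour_const * real (n - m) powr (1 - \<alpha> / 2) + 2 * edge_max"
proof -
  interpret prob_space "nodes {1..n}" by (rule prob_space_nodes)
  have int: "integrable (nodes {1..n}) (\<lambda>y. tour y {1..m})" "integrable (nodes {1..n}) (\<lambda>y. tour y {m+1..n})"
    by (rule integrable_tour; use assms in auto)+
  have split: "{1..n} = {1..m} \<union> {m+1..n}" using assms by auto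
  have "mean_tour n \<le> (\<integral>y. tour y {1..m} + tour y {m+1..n} + 2 * edge_max \<partial>nodes {1..n})"
    unfolding mean_tour_def
  proof (rule integral_mono_AE)
    show "AE y in nodes {1..n}. tour y {1..n} \<le> tour y {1..m} + tour y {m+1..n} + 2 * edge_max"
      using AE_nodes[OF finite_atLeastAtMost]
    proof eventually_elim
      case (elim y)
      show ?case
        unfolding split
      proof (rule min_tour_union)
        show "h (y i) (y j) powr \<alpha> \<le> edge_max"
          if "i \<in> {1..m} \<union> {m+1..n}" "j \<in> {1..m} \<union> {m+1..n}" for i j
          using that elim unfolding split[symmetric] by (intro edge_le_edge_max) auto
      qed (use edge_max_pos in auto)
    qed
  qed (intro Bochner_Integration.integrable_add int integrable_const integrable_tour; simp)+
  also have "\<dots> = mean_tour m + mean_tour (n - m) + 2 * edge_max"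
    using assms int integral_tour[of "{1..n}" "{1..m}"] integral_tour[of "{1..n}" "{m+1..n}"]
    by (simp)
  finally show ?thesis using mean_tour_le[of "n - m"] by simp
qed

text \<open>
  The recursive inequality between different numbers of nodes. For fixed labels \<open>l\<close> the nodes in cell \<open>c\<close>
  are the images of the i.i.d. uniform nodes indexed by \<open>{i. l i = c}\<close>, so their optimal tour has mean weight
  at most \<open>(h0/k) powr \<alpha>\<close> times \<open>mean_tour\<close> of their number.
\<close>

lemma mean_tour_cells:
  assumes k: "1 \<le> k"
  shows "mean_tour n \<le> h0 powr \<alpha> * real k powr - \<alpha> * (\<Sum>c\<in>{..<k}\<times>{..<k}.
      (\<Sum>l\<in>{1..n} \<rightarrow>\<^sub>E {..<k}\<times>{..<k}. mean_tour (card {i\<in>{1..n}. l i = c})) / (real k ^ 2) ^ n)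
    + join_const * real k powr (2 - \<alpha>)"
proof -
  let ?I = "{1..n}" and ?L = "{..<k}\<times>{..<k}"
  define J where "J l c = {i\<in>?I. l i = c}" for l :: "nat \<Rightarrow> nat \<times> nat" and c
  define H where "H = h0 powr \<alpha> * real k powr - \<alpha>"
  define E where "E = join_const * real k powr (2 - \<alpha>)"
  have H: "0 \<le> H" by (simp add: H_def)
  have E: "0 \<le> E" using join_const_nonneg by (simp add: E_def)
  interpret prob_space "nodes ?I" by (rule prob_space_nodes)
  have cells: "(\<integral>\<^sup>+y. ennreal (tour (\<lambda>i\<in>?I. cell_map k (l i) (y i)) ?I) \<partial>nodes ?I) \<le>
      ennreal (H * (\<Sum>c\<in>?L. mean_tour (card (J l c))) + E)"
    if l: "l \<in> ?I \<rightarrow>\<^sub>E ?L" for l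
  proof -
    have int: "integrable (nodes ?I) (\<lambda>y. tour y (J l c))" for c
      by (rule integrable_tour) (auto simp: J_def)
    have "(\<integral>\<^sup>+y. ennreal (tour (\<lambda>i\<in>?I. cell_map k (l i) (y i)) ?I) \<partial>nodes ?I) \<le>
      (\<integral>\<^sup>+y. ennreal (H * (\<Sum>c\<in>?L. tour y (J l c)) + E) \<partial>nodes ?I)"
    proof (rule nn_integral_mono_AE)
      show "AE y in nodes ?I. ennreal (tour (\<lambda>i\<in>?I. cell_map k (l i) (y i)) ?I) \<le>
          ennreal (H * (\<Sum>c\<in>?L. tour y (J l c)) + E)"
        using AE_nodes[OF finite_atLeastAtMost]
      proof eventually_elim
        case (elim y)
        define x where "x = (\<lambda>i\<in>?I. cell_map k (l i) (y i))"
        have "tour x ?I \<le> (\<Sum>c\<in>?L. tour x (J l c)) + E"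
          unfolding E_def J_def using l elim
          by (intro tour_cells[OF _ k]) (auto simp: x_def PiE_iff)
        also have "(\<Sum>c\<in>?L. tour x (J l c)) \<le> (\<Sum>c\<in>?L. H * tour y (J l c))"
        proof (intro sum_mono min_tour_mono)
          fix c i j assume "i \<in> J l c" "j \<in> J l c"
          then show "h (x i) (x j) powr \<alpha> \<le> H * h (y i) (y j) powr \<alpha>"
            using h_cell_map[OF k, of c "y i" "y j"] by (simp add: x_def J_def H_def)
        qed (auto simp: J_def)
        finally show ?case by (simp add: x_def ennreal_leI flip: sum_distrib_left)
      qed
    qed
    also have "\<dots> = ennreal (\<integral>y. H * (\<Sum>c\<in>?L. tour y (J l c)) + E \<partial>nodes ?I)"
    proof (rule nn_integral_eq_integral)
      show "integrable (nodes ?I) (\<lambda>y. H * (\<Sum>c\<in>?L. tour y (J l c)) + E)"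
        by (intro Bochner_Integration.integrable_add integrable_mult_right
            Bochner_Integration.integrable_sum int integrable_const)
      have "finite (J l c)" for c by (simp add: J_def)
      then show "AE y in nodes ?I. 0 \<le> H * (\<Sum>c\<in>?L. tour y (J l c)) + E"
        by (intro AE_I2 add_nonneg_nonneg mult_nonneg_nonneg sum_nonneg min_tour_nonneg H E)
    qed
    also have "(\<integral>y. H * (\<Sum>c\<in>?L. tour y (J l c)) + E \<partial>nodes ?I) =
        H * (\<Sum>c\<in>?L. mean_tour (card (J l c))) + E"
    proof -
      have "(\<integral>y. tour y (J l c) \<partial>nodes ?I) = mean_tour (card (J l c))" for c
        by (rule integral_tour) (auto simp: J_def)
      moreover have "(\<integral>y. H * (\<Sum>c\<in>?L. tour y (J l c)) + E \<partial>nodes ?I) =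
          H * (\<Sum>c\<in>?L. \<integral>y. tour y (J l c) \<partial>nodes ?I) + E"
        using int by (simp)
      ultimately show ?thesis by simp
    qed
    finally show ?thesis .
  qed
  have nonneg: "0 \<le> H * (\<Sum>c\<in>?L. mean_tour (card (J l c))) + E" for l
    by (intro add_nonneg_nonneg mult_nonneg_nonneg sum_nonneg mean_tour_nonneg H E)
  have "ennreal (mean_tour n) = (\<integral>\<^sup>+y. ennreal (tour y ?I) \<partial>nodes ?I)"
    unfolding mean_tour_def
    by (rule nn_integral_eq_integral[symmetric]) (auto intro!: integrable_tour min_tour_nonneg)
  also have "\<dots> \<le> ennreal (1 / real k ^ 2) ^ card ?I *
      (\<Sum>l\<in>?I \<rightarrow>\<^sub>E ?L. \<integral>\<^sup>+y. ennreal (tour (\<lambda>i\<in>?I. cell_map k (l i) (y i)) ?I) \<partial>nodes ?I)"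
  proof (rule nn_integral_PiM_mixture[OF prob_space_unif])
    show "cell_map k c \<in> measurable unif unif" for c
      using cell_map_measurable[of k c] by (simp cong: measurable_cong_sets)
    show "(\<integral>\<^sup>+x. g x \<partial>unif) \<le> ennreal (1 / real k ^ 2) * (\<Sum>c\<in>?L. \<integral>\<^sup>+y. g (cell_map k c y) \<partial>unif)"
      if "g \<in> borel_measurable unif" for g
      using that by (intro nn_integral_unif_cells k) (simp cong: measurable_cong_sets)
    show "(\<lambda>y. ennreal (tour y ?I)) \<in> borel_measurable (nodes ?I)"
      by (intro measurable_compose[OF _ measurable_ennreal] measurable_tour_nodes) auto
  qed simp
  also have "\<dots> \<le> ennreal (1 / real k ^ 2) ^ card ?I *
      (\<Sum>l\<in>?I \<rightarrow>\<^sub>E ?L. ennreal (H * (\<Sum>c\<in>?L. mean_tour (card (J l c))) + E))"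
    by (intro mult_left_mono sum_mono cells) auto
  also have "\<dots> = ennreal ((1 / real k ^ 2) ^ n *
      (\<Sum>l\<in>?I \<rightarrow>\<^sub>E ?L. H * (\<Sum>c\<in>?L. mean_tour (card (J l c))) + E))"
    by (subst sum_ennreal) (simp_all add: nonneg ennreal_power ennreal_mult sum_nonneg)
  finally have "mean_tour n \<le> (1 / real k ^ 2) ^ n *
      (\<Sum>l\<in>?I \<rightarrow>\<^sub>E ?L. H * (\<Sum>c\<in>?L. mean_tour (card (J l c))) + E)"
    by (subst (asm) ennreal_le_iff) (simp_all add: nonneg sum_nonneg)
  also have "(\<Sum>l\<in>?I \<rightarrow>\<^sub>E ?L. H * (\<Sum>c\<in>?L. mean_tour (card (J l c))) + E) =
      H * (\<Sum>c\<in>?L. \<Sum>l\<in>?I \<rightarrow>\<^sub>E ?L. mean_tour (card (J l c))) + (real k ^ 2) ^ n * E"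
  proof -
    have "real (card (?I \<rightarrow>\<^sub>E ?L)) = (real k ^ 2) ^ n"
      by (simp add: card_PiE power2_eq_square)
    moreover have "(\<Sum>c\<in>?L. \<Sum>l\<in>?I \<rightarrow>\<^sub>E ?L. mean_tour (card (J l c))) =
        (\<Sum>l\<in>?I \<rightarrow>\<^sub>E ?L. \<Sum>c\<in>?L. mean_tour (card (J l c)))"
      by (rule sum.swap)
    ultimately show ?thesis
      by (simp only: sum.distrib sum_distrib_left[symmetric] sum_constant)
  qed
  also have "(1 / real k ^ 2) ^ n * \<dots> =
      H * (\<Sum>c\<in>?L. (\<Sum>l\<in>?I \<rightarrow>\<^sub>E ?L. mean_tour (card (J l c))) / (real k ^ 2) ^ n) + E"
    using k by (simp add: power_divide sum_divide_distrib[symmetric] divide_simps)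
  finally show ?thesis by (simp add: H_def E_def J_def)
qed

end

section \<open>Comparing the means for different numbers of nodes\<close>

text \<open>
  Lets second moments control moments of smaller order.
\<close>

lemma powr_le_quadratic:
  fixes x t b :: real
  assumes "0 \<le> x" "0 < t" "0 \<le> b" "b \<le> 2"
  shows "x powr b \<le> t powr b * (1 + x\<^sup>2 / t\<^sup>2)"
proof (cases "x \<le> t")
  case True
  have "x powr b \<le> t powr b" using assms True by (intro powr_mono2) auto
  also have "\<dots> \<le> t powr b * (1 + x\<^sup>2 / t\<^sup>2)"
    by (simp add: mult_le_cancel_left1)
  finally show ?thesis .
next
  case False
  have "x powr b = t powr b * (x / t) powr b"
    using assms by (simp add: powr_divide)
  also have "(x / t) powr b \<le> (x / t) powr 2"
    using assms False by (intro powr_mono) auto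
  also have "(x / t) powr 2 \<le> 1 + x\<^sup>2 / t\<^sup>2"
    using assms by (simp add: power_divide)
  finally show ?thesis using assms by (simp add: mult_left_mono)
qed

text \<open>
  For \<open>k\<close> the integer part of \<open>sqrt (n/a)\<close>, the quotient \<open>n/k^2\<close> is at least \<open>a\<close> and tends to \<open>a\<close>.
\<close>

lemma eventually_grid_size:
  fixes a b :: real
  assumes "0 < a" "a < b"
  shows "\<forall>\<^sub>F n :: nat in sequentially. \<exists>k::nat. 1 \<le> k \<and> a \<le> real n / real k ^ 2 \<and> real n / real k ^ 2 \<le> b"
proof -
  define d where "d = 1 / sqrt a - 1 / sqrt b"
  have d: "0 < d" using assms by (simp add: d_def frac_less2)
  have "\<forall>\<^sub>F n :: nat in sequentially. 1 / d \<le> sqrt (real n)"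
  proof -
    have "filterlim (\<lambda>n. sqrt (real n)) at_top sequentially"
      by (rule filterlim_compose[OF sqrt_at_top filterlim_real_sequentially])
    then show ?thesis by (simp add: filterlim_at_top)
  qed
  then show ?thesis
  proof eventually_elim
    case (elim n)
    define k where "k = nat \<lfloor>sqrt (real n / a)\<rfloor>"
    \<comment> \<open>Leaves room for an integer in between.\<close>
    have gap: "sqrt (real n / b) + 1 \<le> sqrt (real n / a)"
    proof -
      have "1 \<le> sqrt (real n) * d" using elim d by (simp add: field_simps)
      then show ?thesis by (simp add: d_def real_sqrt_divide algebra_simps)
    qed
    have pos: "0 \<le> sqrt (real n / b)" using assms by simp
    have k: "1 \<le> k" "real k \<le> sqrt (real n / a)" "sqrt (real n / b) \<le> real k"
      unfolding k_def using gap pos by linarith+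
    have "real k ^ 2 \<le> real n / a"
      using power_mono[OF k(2), of 2] assms by simp
    moreover have "real n / b \<le> real k ^ 2"
      using power_mono[OF k(3) pos, of 2] assms by simp
    ultimately have "a \<le> real n / real k ^ 2" "real n / real k ^ 2 \<le> b"
      using assms k(1) by (simp_all add: field_simps)
    then show ?case using k(1) by blast
  qed
qed

context homogeneous_weight
begin

text \<open>
  Replaces the random number of nodes in a cell, of mean \<open>\<mu>\<close> and variance at most \<open>\<mu>\<close>, by a fixed
  \<open>m < \<mu>\<close>. With at least \<open>m\<close> nodes the excess is paid for by \<open>mean_tour_add\<close>. Fewer than \<open>m\<close> nodes
  is a deviation by more than \<open>D = \<mu> - m\<close>, unlikely by Chebyshev's inequality, and there the
  worst-case bound is enough. Both cases are captured by one bound that is quadratic in the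
  deviation \<open>z\<close>.
\<close>

lemma mean_tour_occupancy:
  fixes m n k :: nat and \<mu> D :: real
  defines "\<mu> \<equiv> real n / real k ^ 2" and "D \<equiv> \<mu> - real m"
  assumes k: "1 \<le> k" and D: "0 < D" and c: "c \<in> {..<k} \<times> {..<k}"
  shows "(\<Sum>l\<in>{1..n} \<rightarrow>\<^sub>E {..<k}\<times>{..<k}. mean_tour (card {i\<in>{1..n}. l i = c})) / (real k ^ 2) ^ n \<le>
    mean_tour m + 2 * edge_max + tour_const *
      (D powr (1 - \<alpha> / 2) * (3 + 2 * \<mu> / D\<^sup>2) + real m powr (1 - \<alpha> / 2) * \<mu> / D\<^sup>2)"
proof -
  let ?L = "{..<k}\<times>{..<k}" and ?b = "1 - \<alpha> / 2"
  define N where "N l = card {i\<in>{1..n}. l i = c}" for l :: "nat \<Rightarrow> nat \<times> nat"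
  define z where "z l = real (N l) - \<mu>" for l
  \<comment> \<open>The parts of the quadratic bound that are constant and proportional to the squared deviation.\<close>
  define P where "P = mean_tour m + 2 * edge_max + tour_const * (3 * D powr ?b)"
  define Q where "Q = tour_const * (2 * D powr ?b + real m powr ?b) / D\<^sup>2"
  have Q: "0 \<le> Q" using tour_const_pos by (simp add: Q_def)
  have PQ: "P + Q * s = mean_tour m + 2 * edge_max + tour_const *
      (D powr ?b * (3 + 2 * s / D\<^sup>2) + real m powr ?b * s / D\<^sup>2)" for s
    using D by (simp add: P_def Q_def field_simps)
  have b: "0 \<le> ?b" "?b \<le> 2" using alpha_pos alpha_less_2 by auto
  have pointwise: "mean_tour (N l) \<le> P + Q * (z l)\<^sup>2" for l
  proof (cases "m \<le> N l")
    case True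
    have "mean_tour (N l) \<le> mean_tour m + tour_const * real (N l - m) powr ?b + 2 * edge_max"
      using True by (rule mean_tour_add)
    also have "real (N l - m) powr ?b \<le> D powr ?b * (1 + (real (N l - m))\<^sup>2 / D\<^sup>2)"
      using b D by (intro powr_le_quadratic) auto
    also have "(real (N l - m))\<^sup>2 / D\<^sup>2 \<le> 2 + 2 * (z l)\<^sup>2 / D\<^sup>2"
    proof -
      have "real (N l - m) = z l + D" using True by (simp add: z_def D_def)
      moreover have "(z l + D)\<^sup>2 \<le> 2 * D\<^sup>2 + 2 * (z l)\<^sup>2"
        using zero_le_power2[of "z l - D"] by (simp add: power2_eq_square algebra_simps)
      ultimately show ?thesis using D by (simp add: field_simps)
    qed
    also have "1 + (2 + 2 * (z l)\<^sup>2 / D\<^sup>2) = 3 + 2 * (z l)\<^sup>2 / D\<^sup>2" by simp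
    finally have "mean_tour (N l) \<le> mean_tour m + tour_const * (D powr ?b * (3 + 2 * (z l)\<^sup>2 / D\<^sup>2)) + 2 * edge_max"
      using tour_const_pos by (simp add: mult_left_mono)
    also have "\<dots> \<le> P + Q * (z l)\<^sup>2"
      unfolding PQ using tour_const_pos by (simp add: algebra_simps)
    finally show ?thesis .
  next
    case False
    have "D \<le> - z l" using False by (simp add: z_def D_def)
    then have "D\<^sup>2 \<le> (z l)\<^sup>2" using D power_mono[of D "- z l" 2] by simp
    then have "1 \<le> (z l)\<^sup>2 / D\<^sup>2" using D by (simp add: field_simps)
    then have "real m powr ?b * 1 \<le> real m powr ?b * ((z l)\<^sup>2 / D\<^sup>2)"
      by (intro mult_left_mono) auto
    moreover have "0 \<le> D powr ?b * (3 + 2 * (z l)\<^sup>2 / D\<^sup>2)" by simp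
    ultimately have "real m powr ?b \<le> D powr ?b * (3 + 2 * (z l)\<^sup>2 / D\<^sup>2) + real m powr ?b * (z l)\<^sup>2 / D\<^sup>2"
      by (simp only: mult_1_right times_divide_eq_right)
    moreover have "real (N l) powr ?b \<le> real m powr ?b"
      using False b by (intro powr_mono2) auto
    ultimately have "tour_const * real (N l) powr ?b \<le> tour_const *
        (D powr ?b * (3 + 2 * (z l)\<^sup>2 / D\<^sup>2) + real m powr ?b * (z l)\<^sup>2 / D\<^sup>2)"
      using tour_const_pos by (intro mult_left_mono) auto
    then show ?thesis
      unfolding PQ using mean_tour_le[of "N l"] mean_tour_nonneg[of m] edge_max_pos by linarith
  qed
  have K: "0 < (real k ^ 2) ^ n" using k by simp
  have cardL: "card ?L = k ^ 2" by (simp add: power2_eq_square)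
  have var: "(\<Sum>l\<in>{1..n} \<rightarrow>\<^sub>E ?L. (z l)\<^sup>2) \<le> (real k ^ 2) ^ n * \<mu>"
  proof -
    have "(\<Sum>l\<in>{1..n} \<rightarrow>\<^sub>E ?L. (z l)\<^sup>2) =
        (real k ^ 2) ^ n * (real n * (1 / real k ^ 2 * (1 - 1 / real k ^ 2)))"
      using sum_occupancy_variance[of "{1..n}" ?L c] c
      unfolding cardL by (simp add: z_def N_def \<mu>_def)
    also have "real n * (1 / real k ^ 2 * (1 - 1 / real k ^ 2)) \<le> real n * (1 / real k ^ 2 * 1)"
      using k by (intro mult_left_mono) auto
    finally show ?thesis by (simp add: \<mu>_def mult_left_mono)
  qed
  have "(\<Sum>l\<in>{1..n} \<rightarrow>\<^sub>E ?L. mean_tour (N l)) \<le> (\<Sum>l\<in>{1..n} \<rightarrow>\<^sub>E ?L. P + Q * (z l)\<^sup>2)"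
    by (intro sum_mono pointwise)
  also have "\<dots> = (real k ^ 2) ^ n * P + Q * (\<Sum>l\<in>{1..n} \<rightarrow>\<^sub>E ?L. (z l)\<^sup>2)"
    by (simp add: sum.distrib card_PiE cardL flip: sum_distrib_left)
  also have "\<dots> \<le> (real k ^ 2) ^ n * P + Q * ((real k ^ 2) ^ n * \<mu>)"
    by (intro add_left_mono mult_left_mono var Q)
  also have "\<dots> = (P + Q * \<mu>) * (real k ^ 2) ^ n" by (simp add: algebra_simps)
  finally have "(\<Sum>l\<in>{1..n} \<rightarrow>\<^sub>E ?L. mean_tour (N l)) / (real k ^ 2) ^ n \<le> P + Q * \<mu>"
    using K by (simp add: pos_divide_le_eq)
  then show ?thesis unfolding PQ N_def .
qed

text \<open>
  Dividing the recursive inequality by \<open>n powr (1 - \<alpha>/2)\<close>: the number of cells is \<open>n/\<mu>\<close>, so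
  both the contribution of the cells and that of the joins scale exactly like the normalisation.
\<close>

lemma mean_tour_ratio_cells:
  fixes m n k :: nat and \<mu> D :: real
  defines "\<mu> \<equiv> real n / real k ^ 2" and "D \<equiv> \<mu> - real m"
  assumes k: "1 \<le> k" and D: "0 < D"
  shows "mean_tour n / real n powr (1 - \<alpha> / 2) \<le> \<mu> powr - (1 - \<alpha> / 2) *
    (h0 powr \<alpha> * (mean_tour m + 2 * edge_max + tour_const *
      (D powr (1 - \<alpha> / 2) * (3 + 2 * \<mu> / D\<^sup>2) + real m powr (1 - \<alpha> / 2) * \<mu> / D\<^sup>2)) + join_const)"
proof -
  let ?b = "1 - \<alpha> / 2"
  define B where "B = mean_tour m + 2 * edge_max + tour_const *
      (D powr ?b * (3 + 2 * \<mu> / D\<^sup>2) + real m powr ?b * \<mu> / D\<^sup>2)"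
  have \<mu>: "0 < \<mu>" using D by (simp add: D_def)
  then have n: "0 < n" by (auto simp: \<mu>_def intro: Nat.gr0I)
  have npow: "real n powr ?b = \<mu> powr ?b * real k powr (2 - \<alpha>)"
  proof -
    have "real n = \<mu> * real k powr 2" using k by (simp add: \<mu>_def)
    then have "real n powr ?b = \<mu> powr ?b * (real k powr 2) powr ?b"
      using \<mu> by (simp add: powr_mult)
    also have "(real k powr 2) powr ?b = real k powr (2 - \<alpha>)"
      unfolding powr_powr by (simp add: algebra_simps)
    finally show ?thesis .
  qed
  have "mean_tour n \<le> h0 powr \<alpha> * real k powr - \<alpha> * (\<Sum>c\<in>{..<k}\<times>{..<k}. B) + join_const * real k powr (2 - \<alpha>)"
    unfolding B_def \<mu>_def D_def
    by (rule order_trans[OF mean_tour_cells[OF k]])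
       (intro add_right_mono mult_left_mono sum_mono mean_tour_occupancy k, use D in \<open>auto simp: D_def \<mu>_def\<close>)
  also have "\<dots> = real k powr (2 - \<alpha>) * (h0 powr \<alpha> * B + join_const)"
  proof -
    have "real k powr (2 - \<alpha>) = real k powr - \<alpha> * (real k * real k)"
      using k by (simp add: powr_diff powr_minus_divide power2_eq_square)
    then show ?thesis by (simp add: algebra_simps)
  qed
  finally have "mean_tour n / real n powr ?b \<le>
      (real k powr (2 - \<alpha>) * (h0 powr \<alpha> * B + join_const)) / real n powr ?b"
    by (rule divide_right_mono) simp
  also have "(real k powr (2 - \<alpha>) * (h0 powr \<alpha> * B + join_const)) / real n powr ?b =
      \<mu> powr - ?b * (h0 powr \<alpha> * B + join_const)"
    unfolding npow powr_minus_divide using k by simp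
  finally show ?thesis by (simp add: B_def)
qed

text \<open>
  The bound of the previous lemma for \<open>D\<close> of order \<open>m powr (3/4)\<close>. The exponent 3/4 lies
  between 1/2, the order of the fluctuations of the occupation numbers, and 1, the order of \<open>m\<close>
  itself; hence deviations below \<open>m\<close> are rare while the surplus \<open>D\<close> is negligible against \<open>m\<close>.
\<close>

definition ratio_error :: "nat \<Rightarrow> real" where
  "ratio_error m = real m powr - (1 - \<alpha> / 2) *
    (h0 powr \<alpha> * (2 * edge_max + tour_const *
      (18 * real m powr (3 / 4 * (1 - \<alpha> / 2)) + 3 * real m powr (1 - \<alpha> / 2 - 1 / 2))) + join_const)"

lemma eventually_mean_tour_ratio:
  assumes m: "1 \<le> m"
  shows "\<forall>\<^sub>F n in sequentially. mean_tour n / real n powr (1 - \<alpha> / 2) \<le>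
    h0 powr \<alpha> * (mean_tour m / real m powr (1 - \<alpha> / 2)) + ratio_error m"
proof -
  let ?b = "1 - \<alpha> / 2"
  define D0 where "D0 = real m powr (3/4)"
  have b: "0 < ?b" "?b < 1" using alpha_pos alpha_less_2 by auto
  have D0: "1 \<le> D0" "D0 \<le> real m"
    using m powr_mono[of "3/4" 1 "real m"] by (auto simp: D0_def ge_one_powr_ge_zero)
  have "\<forall>\<^sub>F n :: nat in sequentially. \<exists>k::nat. 1 \<le> k \<and>
      real m + D0 \<le> real n / real k ^ 2 \<and> real n / real k ^ 2 \<le> real m + 2 * D0"
    using D0 m by (intro eventually_grid_size) auto
  then show ?thesis
  proof eventually_elim
    case (elim n)
    then obtain k where k: "1 \<le> k" "real m + D0 \<le> real n / real k ^ 2" "real n / real k ^ 2 \<le> real m + 2 * D0"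
      by blast
    define \<mu> where "\<mu> = real n / real k ^ 2"
    define D where "D = \<mu> - real m"
    have D: "D0 \<le> D" "D \<le> 2 * D0" using k by (auto simp: D_def \<mu>_def)
    have Dpos: "0 < D" using D D0 by linarith
    have \<mu>3: "\<mu> \<le> 3 * real m" using k D0 by (simp add: \<mu>_def)
    have \<mu>m: "real m \<le> \<mu>" using k D0 by (simp add: \<mu>_def)
    have q: "\<mu> / D\<^sup>2 \<le> 3 * real m powr (- 1/2)"
    proof -
      have "D0\<^sup>2 \<le> D\<^sup>2" using D D0 by (intro power_mono) auto
      moreover have "D0\<^sup>2 = real m powr (3/2)"
        using powr_powr[of "real m" "3/4" 2] by (simp add: D0_def powr_numeral)
      ultimately have "\<mu> / D\<^sup>2 \<le> (3 * real m) / real m powr (3/2)"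
        using \<mu>3 m Dpos \<mu>m by (intro frac_le) auto
      also have "\<dots> = 3 * (real m powr 1 / real m powr (3/2))" using m by simp
      also have "\<dots> = 3 * real m powr (- 1/2)" by (subst powr_diff[symmetric]) simp
      finally show ?thesis .
    qed
    also have "3 * real m powr (- 1/2) \<le> 3 * real m powr 0"
      using m by (intro mult_left_mono powr_mono) auto
    finally have q3: "\<mu> / D\<^sup>2 \<le> 3" using m by simp
    have "D powr ?b * (3 + 2 * \<mu> / D\<^sup>2) \<le> (2 * real m powr (3 / 4 * ?b)) * 9"
    proof (rule mult_mono)
      have "D powr ?b \<le> (2 * D0) powr ?b" using D Dpos b by (intro powr_mono2) auto
      also have "\<dots> = 2 powr ?b * real m powr (3/4 * ?b)" by (simp add: D0_def powr_mult powr_powr)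
      also have "\<dots> \<le> 2 powr 1 * real m powr (3/4 * ?b)"
        using b by (intro mult_right_mono powr_mono) auto
      finally show "D powr ?b \<le> 2 * real m powr (3/4 * ?b)" by simp
    qed (use q3 \<mu>m in auto)
    moreover have "real m powr ?b * \<mu> / D\<^sup>2 \<le> 3 * real m powr (?b - 1/2)"
    proof -
      have "real m powr ?b * (\<mu> / D\<^sup>2) \<le> real m powr ?b * (3 * real m powr (- 1/2))"
        by (intro mult_left_mono q) simp
      also have "\<dots> = 3 * (real m powr ?b * real m powr (- 1/2))" by simp
      also have "\<dots> = 3 * real m powr (?b - 1/2)" unfolding powr_add[symmetric] by simp
      finally show ?thesis by simp
    qed
    ultimately have "D powr ?b * (3 + 2 * \<mu> / D\<^sup>2) + real m powr ?b * \<mu> / D\<^sup>2 \<le>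
        18 * real m powr (3 / 4 * ?b) + 3 * real m powr (?b - 1/2)" (is "?X \<le> ?Y") by simp
    then have XY: "tour_const * ?X \<le> tour_const * ?Y" using tour_const_pos by (intro mult_left_mono) auto
    have "mean_tour n / real n powr ?b \<le> \<mu> powr - ?b *
        (h0 powr \<alpha> * (mean_tour m + 2 * edge_max + tour_const * ?X) + join_const)"
      unfolding \<mu>_def D_def using k(1) Dpos by (intro mean_tour_ratio_cells) (auto simp: \<mu>_def D_def)
    also have "\<dots> \<le> real m powr - ?b *
        (h0 powr \<alpha> * (mean_tour m + 2 * edge_max + tour_const * ?Y) + join_const)"
    proof (rule mult_mono)
      show "\<mu> powr - ?b \<le> real m powr - ?b" using m \<mu>m b by (intro powr_mono2') auto
      show "h0 powr \<alpha> * (mean_tour m + 2 * edge_max + tour_const * ?X) + join_const \<le>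
          h0 powr \<alpha> * (mean_tour m + 2 * edge_max + tour_const * ?Y) + join_const"
        using XY by (intro add_right_mono mult_left_mono) auto
      show "0 \<le> h0 powr \<alpha> * (mean_tour m + 2 * edge_max + tour_const * ?X) + join_const"
        using mean_tour_nonneg[of m] edge_max_pos tour_const_pos join_const_nonneg \<mu>m
        by (intro add_nonneg_nonneg mult_nonneg_nonneg) auto
    qed simp
    also have "\<dots> = h0 powr \<alpha> * (mean_tour m / real m powr ?b) + ratio_error m"
      unfolding ratio_error_def powr_minus_divide[of "real m" ?b] by (simp add: algebra_simps add_divide_distrib)
    finally show ?case .
  qed
qed

lemma ratio_error_tendsto: "ratio_error \<longlonglongrightarrow> 0"
proof -
  let ?b = "1 - \<alpha> / 2"
  have null: "(\<lambda>m. real m powr - s) \<longlonglongrightarrow> 0" if "0 < s" for s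
    by (intro tendsto_neg_powr filterlim_real_sequentially) (use that in simp)
  have "(\<lambda>m. (h0 powr \<alpha> * (2 * edge_max) + join_const) * real m powr - ?b +
      h0 powr \<alpha> * tour_const * 18 * real m powr - (?b / 4) +
      h0 powr \<alpha> * tour_const * 3 * real m powr - (1 / 2)) \<longlonglongrightarrow>
      (h0 powr \<alpha> * (2 * edge_max) + join_const) * 0 + h0 powr \<alpha> * tour_const * 18 * 0 + h0 powr \<alpha> * tour_const * 3 * 0"
    using alpha_less_2 by (intro tendsto_add tendsto_mult tendsto_const null) auto
  moreover have "(h0 powr \<alpha> * (2 * edge_max) + join_const) * real m powr - ?b +
      h0 powr \<alpha> * tour_const * 18 * real m powr - (?b / 4) +
      h0 powr \<alpha> * tour_const * 3 * real m powr - (1 / 2) = ratio_error m" for m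
  proof -
    have "real m powr - (?b / 4) = real m powr - ?b * real m powr (3 / 4 * ?b)"
      unfolding powr_add[symmetric] by (rule arg_cong[of _ _ "(powr) (real m)"]) (simp add: field_simps)
    moreover have "real m powr - (1 / 2) = real m powr - ?b * real m powr (?b - 1 / 2)"
      unfolding powr_add[symmetric] by (rule arg_cong[of _ _ "(powr) (real m)"]) simp
    ultimately show ?thesis unfolding ratio_error_def by (simp only: algebra_simps)
  qed
  ultimately show ?thesis by simp
qed

end

section \<open>Lower bound from close pairs\<close>

text \<open>
  Map each vertex of the tour to the edge leaving it. Such an edge weighs at least \<open>(c1 * r) powr \<alpha>\<close>
  unless its endpoints are within distance \<open>r\<close>, and different vertices use different ordered pairs,
  so the number of exceptions is at most the number of close pairs.
\<close>

lemma min_tour_ge_isolated: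
  fixes x :: "nat \<Rightarrow> 'p::metric_space"
  assumes lower: "\<And>u v. c1 * dist u v \<le> h u v" and "0 < c1" "0 < \<alpha>" "0 \<le> r" and J: "finite J" "2 \<le> card J"
  shows "(c1 * r) powr \<alpha> * (real (card J) -
      (\<Sum>(i, j)\<in>{(i, j) \<in> J \<times> J. i \<noteq> j}. if dist (x i) (x j) < r then 1 else 0)) \<le> min_tour h \<alpha> x J"
proof -
  obtain vs where vs: "distinct vs" "set vs = J" "min_tour h \<alpha> x J = cycle_weight h \<alpha> x vs"
    by (rule min_tour_attained[OF J(1)])
  define near where "near = (\<lambda>(i, j). if dist (x i) (x j) < r then 1 else (0::real))"
  define R where "R = {(i, j) \<in> J \<times> J. i \<noteq> j}"
  define e where "e k = (vs ! k, vs ! (Suc k mod length vs))" for k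
  have len: "length vs = card J" using distinct_card[OF vs(1)] vs(2) by simp
  have "finite R" using J(1) by (auto simp: R_def intro: finite_subset[of _ "J \<times> J"])
  have inj: "inj_on e {..<length vs}"
    using vs(1) by (auto simp: inj_on_def e_def nth_eq_iff_index_eq)
  have sub: "e ` {..<length vs} \<subseteq> R"
  proof safe
    fix k i j assume k: "k < length vs" and e: "(i, j) = e k"
    have "Suc k mod length vs < length vs" using k by (intro mod_less_divisor) auto
    moreover have "Suc k mod length vs \<noteq> k"
      using k J(2) len by (cases "Suc k = length vs") auto
    ultimately show "(i, j) \<in> R"
      using k e vs(1,2) by (auto simp: R_def e_def nth_eq_iff_index_eq)
  qed
  have "(\<Sum>k<length vs. near (e k)) = (\<Sum>p\<in>e ` {..<length vs}. near p)"
    using inj by (simp add: sum.reindex)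
  also have "\<dots> \<le> (\<Sum>p\<in>R. near p)"
    using sub \<open>finite R\<close> by (intro sum_mono2) (auto simp: near_def)
  finally have near: "(\<Sum>k<length vs. near (e k)) \<le> (\<Sum>p\<in>R. near p)" .
  have "(c1 * r) powr \<alpha> * (real (card J) - (\<Sum>p\<in>R. near p)) \<le>
      (c1 * r) powr \<alpha> * (real (card J) - (\<Sum>k<length vs. near (e k)))"
    using near by (intro mult_left_mono) auto
  also have "\<dots> = (\<Sum>k<length vs. (c1 * r) powr \<alpha> * (1 - near (e k)))"
    by (simp add: sum_subtractf len flip: sum_distrib_left)
  also have "\<dots> \<le> cycle_weight h \<alpha> x vs"
    unfolding cycle_weight_def
  proof (rule sum_mono)
    fix k assume "k \<in> {..<length vs}"
    let ?u = "x (vs ! k)" and ?v = "x (vs ! (Suc k mod length vs))"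
    show "(c1 * r) powr \<alpha> * (1 - near (e k)) \<le> h ?u ?v powr \<alpha>"
    proof (cases "dist ?u ?v < r")
      case True
      then show ?thesis by (simp add: near_def e_def)
    next
      case False
      then have "c1 * r \<le> c1 * dist ?u ?v" using \<open>0 < c1\<close> by simp
      also have "\<dots> \<le> h ?u ?v" by (rule lower)
      finally have "(c1 * r) powr \<alpha> \<le> h ?u ?v powr \<alpha>"
        using assms(2-4) by (intro powr_mono2) auto
      then show ?thesis using False by (simp add: near_def e_def)
    qed
  qed
  finally show ?thesis using vs(3) by (simp add: near_def R_def)
qed

lemma nn_integral_unif_ball:
  assumes "0 \<le> r"
  shows "(\<integral>\<^sup>+y. (if dist y p < r then 1 else 0) \<partial>unif) \<le> ennreal (4 * r\<^sup>2)"
proof -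
  let ?C = "cbox (\<chi> i. p $ i - r) (\<chi> i. p $ i + r) :: (real^2) set"
  have le: "(if dist y p < r then 1 else 0) * indicator unit_square y \<le> (indicator ?C y :: ennreal)" for y
  proof -
    have "y \<in> ?C" if "dist y p < r"
    proof -
      have "\<bar>y $ i - p $ i\<bar> \<le> r" for i
        using component_le_norm_cart[of "y - p" i] that by (simp add: dist_norm)
      then show ?thesis by (auto simp: mem_box_cart abs_le_iff algebra_simps)
    qed
    then show ?thesis by (auto simp: indicator_def)
  qed
  have side: "((\<chi> i. p $ i + r) - (\<chi> i. p $ i - r)) \<bullet> b = 2 * r" if "b \<in> Basis" for b :: "real^2"
    using that by (auto simp: Basis_vec_def inner_axis)
  have vol: "emeasure lborel ?C = ennreal (4 * r\<^sup>2)"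
  proof -
    have "(\<chi> i. p $ i - r) \<bullet> b \<le> (\<chi> i. p $ i + r) \<bullet> b" if "b \<in> Basis" for b :: "real^2"
      using side[OF that] assms by (simp add: inner_diff_left)
    moreover have "prod ((\<bullet>) ((\<chi> i. p $ i + r) - (\<chi> i. p $ i - r))) (Basis :: (real^2) set) = (\<Prod>b\<in>(Basis :: (real^2) set). 2 * r)"
      using side by (intro prod.cong) auto
    moreover have "(\<Prod>b\<in>(Basis :: (real^2) set). 2 * r) = 4 * r\<^sup>2"
      by (simp add: power2_eq_square)
    ultimately show ?thesis by (subst emeasure_lborel_cbox) auto
  qed
  have "(\<integral>\<^sup>+y. (if dist y p < r then 1 else 0) \<partial>unif) =
      (\<integral>\<^sup>+y. (if dist y p < r then 1 else 0) * indicator unit_square y \<partial>lborel)"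
    by (subst nn_integral_uniform_measure) (auto simp: emeasure_unit_square divide_ennreal_def)
  also have "\<dots> \<le> (\<integral>\<^sup>+y. indicator ?C y \<partial>lborel)"
    by (intro nn_integral_mono le)
  finally show ?thesis by (simp add: vol)
qed

context homogeneous_weight
begin

lemma measurable_near:
  assumes "i \<in> I" "j \<in> I"
  shows "(\<lambda>y. if dist (y i) (y j) < r then 1 else 0) \<in> borel_measurable (nodes I)"
proof -
  have "(\<lambda>y. y i) \<in> measurable (nodes I) unif" if "i \<in> I" for i
    using that by (rule measurable_component_singleton)
  then have [measurable]: "(\<lambda>y. y i) \<in> borel_measurable (nodes I)" if "i \<in> I" for i
    using that by (simp cong: measurable_cong_sets)
  show ?thesis using assms by measurable
qed

lemma nodes_near:
  assumes I: "finite I" "i \<in> I" "j \<in> I" "i \<noteq> j" and r: "0 \<le> r"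
  shows "integrable (nodes I) (\<lambda>y. if dist (y i) (y j) < r then 1 else (0::real))"
    and "(\<integral>y. (if dist (y i) (y j) < r then 1 else 0) \<partial>nodes I) \<le> 4 * r\<^sup>2"
proof -
  interpret U: prob_space unif by (rule prob_space_unif)
  interpret product_sigma_finite "\<lambda>_::nat. unif" by standard
  define I' where "I' = I - {i}"
  have I': "I = insert i I'" "finite I'" "i \<notin> I'" "j \<in> I'" using I by (auto simp: I'_def)
  interpret N: prob_space "nodes I'" by (rule prob_space_nodes)
  interpret P: prob_space "nodes I" by (rule prob_space_nodes)
  show int: "integrable (nodes I) (\<lambda>y. if dist (y i) (y j) < r then 1 else (0::real))"
    using I by (intro P.integrable_const_bound[where B=1] measurable_near) auto
  have "(\<integral>\<^sup>+y. (if dist (y i) (y j) < r then 1 else 0) \<partial>nodes (insert i I')) =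
      (\<integral>\<^sup>+x. (\<integral>\<^sup>+y. (if dist ((x(i := y)) i) ((x(i := y)) j) < r then 1 else 0) \<partial>unif) \<partial>nodes I')"
    using I' by (intro product_nn_integral_insert measurable_near) auto
  also have "\<dots> = (\<integral>\<^sup>+x. (\<integral>\<^sup>+y. (if dist y (x j) < r then 1 else 0) \<partial>unif) \<partial>nodes I')"
    using I' by (intro nn_integral_cong) auto
  also have "\<dots> \<le> (\<integral>\<^sup>+x. ennreal (4 * r\<^sup>2) \<partial>nodes I')"
    by (intro nn_integral_mono nn_integral_unif_ball r)
  also have "\<dots> = ennreal (4 * r\<^sup>2)" by (simp add: N.emeasure_space_1)
  finally have "(\<integral>\<^sup>+y. (if dist (y i) (y j) < r then 1 else 0) \<partial>nodes I) \<le> ennreal (4 * r\<^sup>2)"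
    by (simp only: I'(1)[symmetric])
  also have "(\<integral>\<^sup>+y. (if dist (y i) (y j) < r then 1 else 0) \<partial>nodes I) =
      (\<integral>\<^sup>+y. ennreal (if dist (y i) (y j) < r then 1 else 0) \<partial>nodes I)"
    by (intro nn_integral_cong) auto
  also have "\<dots> = ennreal (\<integral>y. (if dist (y i) (y j) < r then 1 else 0) \<partial>nodes I)"
    by (intro nn_integral_eq_integral int) auto
  finally show "(\<integral>y. (if dist (y i) (y j) < r then 1 else 0) \<partial>nodes I) \<le> 4 * r\<^sup>2"
    by (simp add: ennreal_le_iff)
qed

text \<open>
  A given pair of nodes is within distance \<open>r\<close> with probability at most \<open>4 * r\<^sup>2\<close>. The value
  \<open>r\<^sup>2 = 1/(8*n)\<close> makes the expected number of close ordered pairs at most \<open>n/2\<close>, so half of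
  the \<open>n\<close> edges are long on average.
\<close>

lemma mean_tour_ge:
  assumes lower: "\<And>u v. c1 * dist u v \<le> h u v" and c1: "0 < c1" and n: "2 \<le> n"
  shows "(c1 / sqrt 8) powr \<alpha> / 2 * real n powr (1 - \<alpha> / 2) \<le> mean_tour n"
proof -
  define r where "r = 1 / sqrt (8 * real n)"
  define R where "R = {(i, j) \<in> {1..n} \<times> {1..n}. i \<noteq> j}"
  define near where "near p y = (case p of (i, j) \<Rightarrow> if dist (y i) (y j) < r then 1 else (0::real))"
    for p and y :: "nat \<Rightarrow> real^2"
  have r: "0 \<le> r" "r\<^sup>2 = 1 / (8 * real n)" using n by (auto simp: r_def power_divide)
  have int: "integrable (nodes {1..n}) (near p)" and le: "(\<integral>y. near p y \<partial>nodes {1..n}) \<le> 4 * r\<^sup>2"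
    if pR: "p \<in> R" for p
  proof -
    obtain i j where p: "p = (i, j)" "i \<in> {1..n}" "j \<in> {1..n}" "i \<noteq> j" using pR by (auto simp: R_def)
    show "integrable (nodes {1..n}) (near p)" "(\<integral>y. near p y \<partial>nodes {1..n}) \<le> 4 * r\<^sup>2"
      unfolding near_def p(1) prod.case using nodes_near[OF finite_atLeastAtMost p(2-4) r(1)] by simp_all
  qed
  have "card R \<le> card ({1..n} \<times> {1..n})" by (intro card_mono) (auto simp: R_def)
  then have "card R \<le> n * n" by simp
  then have cardO: "real (card R) \<le> real n * real n" by (metis of_nat_le_iff of_nat_mult)
  have "(c1 / sqrt 8) powr \<alpha> / 2 * real n powr (1 - \<alpha> / 2) = (c1 * r) powr \<alpha> * (real n / 2)"
  proof -
    have "(c1 * r) powr \<alpha> = (c1 / sqrt 8) powr \<alpha> * real n powr - (\<alpha> / 2)"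
    proof -
      have "c1 * r = (c1 / sqrt 8) * real n powr - (1/2)"
        using n by (simp add: r_def real_sqrt_mult powr_minus_divide powr_half_sqrt)
      then have "(c1 * r) powr \<alpha> = (c1 / sqrt 8) powr \<alpha> * (real n powr - (1/2)) powr \<alpha>"
        using c1 by (simp only: powr_mult)
      then show ?thesis by (simp add: powr_powr)
    qed
    moreover have "real n powr (1 - \<alpha> / 2) = real n powr - (\<alpha> / 2) * real n"
      using n powr_add[of "real n" "- (\<alpha> / 2)" 1] by (simp add: algebra_simps)
    ultimately show ?thesis by simp
  qed
  also have "\<dots> \<le> (c1 * r) powr \<alpha> * (real n - (\<Sum>p\<in>R. \<integral>y. near p y \<partial>nodes {1..n}))"
  proof (rule mult_left_mono)
    have "(\<Sum>p\<in>R. \<integral>y. near p y \<partial>nodes {1..n}) \<le> real (card R) * (4 * r\<^sup>2)"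
      using le by (rule sum_bounded_above)
    also have "\<dots> \<le> real n * real n * (4 * r\<^sup>2)" using cardO by (intro mult_right_mono) auto
    also have "\<dots> = real n / 2" using n by (simp add: r(2))
    finally show "real n / 2 \<le> real n - (\<Sum>p\<in>R. \<integral>y. near p y \<partial>nodes {1..n})" by simp
  qed simp
  also have "\<dots> = (\<integral>y. (c1 * r) powr \<alpha> * (real n - (\<Sum>p\<in>R. near p y)) \<partial>nodes {1..n})"
    using int by simp
  also have "\<dots> \<le> mean_tour n"
    unfolding mean_tour_def
  proof (rule integral_mono)
    show "integrable (nodes {1..n}) (\<lambda>y. (c1 * r) powr \<alpha> * (real n - (\<Sum>p\<in>R. near p y)))"
      using int by (intro integrable_mult_right Bochner_Integration.integrable_diff
          Bochner_Integration.integrable_sum integrable_const_nodes)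
    show "(c1 * r) powr \<alpha> * (real n - (\<Sum>p\<in>R. near p y)) \<le> tour y {1..n}" for y
      using min_tour_ge_isolated[OF lower c1 alpha_pos r(1), of "{1..n}" y] n
      by (simp add: near_def R_def case_prod_unfold)
  qed (auto intro: integrable_tour)
  finally show ?thesis .
qed

section \<open>The limits\<close>

lemma expectation_TSP:
  assumes M: "prob_space M" and indep: "prob_space.indep_vars M (\<lambda>_. borel) X {1..}"
    and distr: "\<And>i. 1 \<le> i \<Longrightarrow> distr M borel (X i) = unif" and n: "3 \<le> n"
  shows "(\<integral>\<omega>. TSP h \<alpha> (\<lambda>i. X i \<omega>) n \<partial>M) = mean_tour n"
proof -
  interpret prob_space M by (rule M)
  have rv: "X i \<in> borel_measurable M" if "i \<in> {1..n}" for i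
    using indep that by (auto simp: indep_vars_def)
  have "indep_vars (\<lambda>_. borel) X {1..n}"
    by (rule indep_vars_subset[OF indep]) auto
  then have "distr M (PiM {1..n} (\<lambda>_. borel)) (\<lambda>\<omega>. \<lambda>i\<in>{1..n}. X i \<omega>) =
      PiM {1..n} (\<lambda>i. distr M borel (X i))"
    using indep_vars_iff_distr_eq_PiM'[where I="{1..n}" and M'="\<lambda>_. borel" and X=X] rv n by auto
  also have "\<dots> = nodes {1..n}"
    using distr by (intro PiM_cong) auto
  finally have D: "nodes {1..n} = distr M (PiM {1..n} (\<lambda>_. borel)) (\<lambda>\<omega>. \<lambda>i\<in>{1..n}. X i \<omega>)" ..
  have "mean_tour n = (\<integral>\<omega>. tour (\<lambda>i\<in>{1..n}. X i \<omega>) {1..n} \<partial>M)"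
    unfolding mean_tour_def D
  proof (rule integral_distr)
    show "(\<lambda>\<omega>. \<lambda>i\<in>{1..n}. X i \<omega>) \<in> measurable M (PiM {1..n} (\<lambda>_. borel))"
      using rv by (rule measurable_restrict)
    show "(\<lambda>y. tour y {1..n}) \<in> borel_measurable (PiM {1..n} (\<lambda>_. borel))"
      by (rule measurable_tour[of _ "\<lambda>i y. y i"]) auto
  qed
  also have "\<dots> = (\<integral>\<omega>. TSP h \<alpha> (\<lambda>i. X i \<omega>) n \<partial>M)"
    using n by (intro Bochner_Integration.integral_cong refl)
      (simp add: TSP_eq_min_tour, intro min_tour_cong, auto)
  finally show ?thesis ..
qed

text \<open>
  For the last claim, \<open>limsup s\<close> is at most \<open>h0 powr \<alpha> * s m + ratio_error m\<close> for
  every fixed \<open>m \<ge> 1\<close>, so the limit inferior may be taken over \<open>m\<close>.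
\<close>

lemma mean_tour_limits:
  assumes lower: "\<And>u v. c1 * dist u v \<le> h u v" and c1: "0 < c1"
  defines "s \<equiv> \<lambda>n. ereal (mean_tour n / real n powr (1 - \<alpha> / 2))"
  shows "0 < liminf s" and "liminf s < \<infinity>" and "limsup s \<le> ereal (h0 powr \<alpha>) * liminf s"
proof -
  let ?b = "1 - \<alpha> / 2"
  have "ereal ((c1 / sqrt 8) powr \<alpha> / 2) \<le> liminf s"
  proof (rule Liminf_bounded)
    show "\<forall>\<^sub>F n in sequentially. ereal ((c1 / sqrt 8) powr \<alpha> / 2) \<le> s n"
      using eventually_ge_at_top[of "2::nat"]
    proof eventually_elim
      case (elim n)
      then show ?case using mean_tour_ge[OF lower c1 elim] by (simp add: s_def pos_le_divide_eq)
    qed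
  qed
  moreover have "0 < ereal ((c1 / sqrt 8) powr \<alpha> / 2)" using c1 by simp
  ultimately show "0 < liminf s" by (rule less_le_trans[rotated])
  have "liminf s \<le> limsup s" by (rule Liminf_le_Limsup) simp
  also have "limsup s \<le> ereal tour_const"
  proof (rule Limsup_bounded)
    show "\<forall>\<^sub>F n in sequentially. s n \<le> ereal tour_const"
      using eventually_ge_at_top[of "1::nat"]
    proof eventually_elim
      case (elim n)
      then show ?case using mean_tour_le[of n] by (simp add: s_def pos_divide_le_eq)
    qed
  qed
  finally show "liminf s < \<infinity>" by (rule le_less_trans) simp
  have "limsup s \<le> liminf (\<lambda>m. ereal (ratio_error m) + ereal (h0 powr \<alpha>) * s m)"
  proof (rule Liminf_bounded)
    show "\<forall>\<^sub>F m in sequentially. limsup s \<le> ereal (ratio_error m) + ereal (h0 powr \<alpha>) * s m"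
      using eventually_ge_at_top[of "1::nat"]
    proof eventually_elim
      case (elim m)
      show ?case
        using eventually_mean_tour_ratio[OF elim]
        by (intro Limsup_bounded) (simp add: s_def add.commute)
    qed
  qed
  also have "\<dots> = 0 + liminf (\<lambda>m. ereal (h0 powr \<alpha>) * s m)"
    by (rule ereal_liminf_lim_add) (use ratio_error_tendsto in \<open>auto simp: zero_ereal_def\<close>)
  also have "\<dots> = ereal (h0 powr \<alpha>) * liminf s"
    by (simp add: Liminf_ereal_mult_left)
  finally show "limsup s \<le> ereal (h0 powr \<alpha>) * liminf s" .
qed

end

theorem theorem9:
  fixes M :: "'a measure"
    and X :: "nat \<Rightarrow> 'a \<Rightarrow> real^2"
    and h :: "real^2 \<Rightarrow> real^2 \<Rightarrow> real"
    and c1 c2 h0 \<alpha> :: real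
  assumes "prob_space M"
    and "prob_space.indep_vars M (\<lambda>_. borel) X {1..}"
    and "\<And>i. 1 \<le> i \<Longrightarrow> distr M borel (X i) = uniform_measure lborel unit_square"
    and "(\<lambda>(u, v). h u v) \<in> borel_measurable borel"
    and "\<And>u v. 0 \<le> h u v"
    and "0 < c1" and "0 < c2"
    and "\<And>u v. c1 * dist u v \<le> h u v"
    and "\<And>u v. h u v = h v u"
    and "\<And>u v. h u v \<le> c2 * dist u v"
    and b1: "\<And>a u v. 0 < a \<Longrightarrow> h (a *\<^sub>R u) (a *\<^sub>R v) = a * h u v"
    and "0 < h0"
    and b2: "\<And>b u v. h (b + u) (b + v) \<le> h0 * h u v"
    and "0 < \<alpha>" and "\<alpha> < 2"
  defines "r \<equiv> \<lambda>n. ereal ((\<integral>\<omega>. TSP h \<alpha> (\<lambda>i. X i \<omega>) n \<partial>M) / real n powr (1 - \<alpha> / 2))"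
  shows "0 < liminf r
    \<and> liminf r \<le> limsup r
    \<and> limsup r \<le> ereal (h0 powr \<alpha>) * liminf r
    \<and> ereal (h0 powr \<alpha>) * liminf r < \<infinity>"
proof -
  interpret homogeneous_weight h c2 h0 \<alpha>
    by unfold_locales (fact assms b1 b2)+
  define s where "s n = ereal (mean_tour n / real n powr (1 - \<alpha> / 2))" for n
  have rs: "\<forall>\<^sub>F n in sequentially. r n = s n"
    using eventually_ge_at_top[of "3::nat"]
    by eventually_elim (simp add: r_def s_def expectation_TSP[OF assms(1-3)])
  have eq: "liminf r = liminf s" "limsup r = limsup s"
    using rs by (auto intro: Liminf_eq Limsup_eq)
  have lim: "0 < liminf s" "liminf s < \<infinity>" "limsup s \<le> ereal (h0 powr \<alpha>) * liminf s"
    unfolding s_def using mean_tour_limits[OF assms(8) \<open>0 < c1\<close>] by auto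
  have "ereal (h0 powr \<alpha>) * liminf s < \<infinity>"
    using lim by (cases "liminf s") auto
  moreover have "liminf s \<le> limsup s" by (rule Liminf_le_Limsup) simp
  ultimately show ?thesis using lim unfolding eq by blast
qed

end
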